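(* Let $W$ be a finite Coxeter group with fixed Coxeter element $c$ and let $k$ be a positive integer. Let $(\pi)_k=(\pi_1,\ldots,\pi_k)\in NC^{(k)}(W)$, put $\pi_{k+1}=c$, and let $(\delta)_k=(\delta_1,\ldots,\delta_k)$ with $\delta_i=\pi_i^{-1}\pi_{i+1}$ be the corresponding delta sequence. Let $W'$ be the parabolic subgroup of $W$ in which $\pi_1$ is a Coxeter element, and define $NC^{(k)}(W')$ and $NC_{(k)}(W')$ with respect to the Coxeter element $\pi_1$ of $W'$. Then: (1) The principal order ideal $\{(\mu)_k\in NC^{(k)}(W):(\mu)_k\leq(\pi)_k\}$ is isomorphic as a poset to $NC^{(k)}(W')$ via the map $$(\mu_1,\mu_2,\ldots,\mu_k)\mapsto(\mu_1,\ \mu_2\pi_2^{-1}\pi_1,\ \mu_3\pi_3^{-1}\pi_1,\ \ldots,\ \mu_k\pi_k^{-1}\pi_1).$$ (2) The principal order filter $\{(\varepsilon)_k\in NC_{(k)}(W):(\delta)_k\leq(\varepsilon)_k\}$ is isomorphic as a poset to $NC_{(k)}(W')$ via the map whose $i$-th entry is $$\pi_1^{-1}\pi_i\,\varepsilon_i\,\pi_{i+1}^{-1}\pi_1\qquad(1\leq i\leq k).$$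
   Context: Let $(W,S)$ be a finite Coxeter system, $T=\{wsw^{-1}:s\in S,w\in W\}$ its set of reflections, and $\ell_T$ the word length on $W$ with respect to $T$. The absolute order is $\pi\leq_T\mu \iff \ell_T(\mu)=\ell_T(\pi)+\ell_T(\pi^{-1}\mu)$. A Coxeter element is any $W$-conjugate of a product of all elements of $S$ in some order; fix one, $c$, and put $NC(W)=\{w\in W:1\leq_T w\leq_T c\}$. A $k$-multichain is $(\pi)_k=(\pi_1,\ldots,\pi_k)$ with all $\pi_i\in NC(W)$ and $\pi_1\leq_T\cdots\leq_T\pi_k$; put $\pi_{k+1}=c$. $NC^{(k)}(W)$ is the set of $k$-multichains with $(\pi)_k\leq(\mu)_k$ iff $\mu_i^{-1}\mu_{i+1}\leq_T\pi_i^{-1}\pi_{i+1}$ for all $1\leq i\leq k$. A $k$-delta sequence is $(\delta)_k=(\delta_1,\ldots,\delta_k)\in NC(W)^k$ such that, with $\delta_0=c(\delta_1\cdots\delta_k)^{-1}$, $\ell_T(c)=\sum_{i=0}^k\ell_T(\delta_i)$. $NC_{(k)}(W)$ is the set of $k$-delta sequences ordered componentwise by $\leq_T$. The map $(\pi)_k\mapsto(\pi_i^{-1}\pi_{i+1})_{1\le i\le k}$ is an order-reversing bijection $NC^{(k)}(W)\to NC_{(k)}(W)$. A parabolic subgroup is a subgroup $w\langle I\rangle w^{-1}$ with $I\subseteq S$, $w\in W$; it is a Coxeter group with Coxeter generators $wIw^{-1}$. Every $\pi\in NC(W)$ is a Coxeter element of a unique parabolic subgroup, namely the subgroup generated by $\{t\in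 T:t\leq_T\pi\}$. For a parabolic subgroup $W'$ with Coxeter generators $S'$ and Coxeter element $c'$, let $T'=\{usu^{-1}:s\in S',u\in W'\}$ be the set of reflections of $W'$, let $\ell_{T'}$ be the word length on $W'$ with respect to $T'$ (it equals the restriction of $\ell_T$ to $W'$), let $\leq_{T'}$ be the absolute order on $W'$, given by $\pi\leq_{T'}\mu\iff\ell_{T'}(\mu)=\ell_{T'}(\pi)+\ell_{T'}(\pi^{-1}\mu)$, and put $NC(W')=\{u\in W':1\leq_{T'}u\leq_{T'}c'\}$. Then $NC^{(k)}(W')$ is the set of $k$-tuples $(\pi)_k=(\pi_1,\ldots,\pi_k)$ with all $\pi_i\in NC(W')$ and $\pi_1\leq_{T'}\cdots\leq_{T'}\pi_k$, partially ordered by setting $(\pi)_k\leq(\mu)_k$ iff $\mu_i^{-1}\mu_{i+1}\leq_{T'}\pi_i^{-1}\pi_{i+1}$ for all $1\leq i\leq k$, where $\pi_{k+1}=\mu_{k+1}=c'$; and $NC_{(k)}(W')$ is the set of $k$-tuples $(\delta)_k=(\delta_1,\ldots,\delta_k)\in NC(W')^k$ such that, with $\delta_0=c'(\delta_1\cdots\delta_k)^{-1}$, $\ell_{T'}(c')=\sum_{i=0}^k\ell_{T'}(\delta_i)$, ordered componentwise by $\leq_{T'}$. *)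

theory Defs
  imports "HOL-Algebra.Multiplicative_Group"
begin

text \<open>
  Everything is relative to a group \<open>G\<close> (an explicit record) and a set \<open>S\<close> of generators, so that
  the same constants apply to \<open>W\<close> and, with \<open>G\<lparr>carrier := H\<rparr>\<close>, to a parabolic subgroup \<open>H\<close>.
\<close>

definition list_prod :: "('a, 'b) monoid_scheme \<Rightarrow> 'a list \<Rightarrow> 'a" where
  "list_prod G xs = foldr (\<otimes>\<^bsub>G\<^esub>) xs \<one>\<^bsub>G\<^esub>"

text \<open>
  The congruence on words over \<open>S\<close> generated by the relations \<open>(st)\<^bsup>m(s,t)\<^esup> = 1\<close>, where
  \<open>m(s,t)\<close> is the order of \<open>st\<close> in \<open>G\<close> (an infinite order is \<open>0\<close> in the library, which gives the
  empty relation). For involutions \<open>s = t\<close> the relation is \<open>s s = 1\<close>; hence words without formal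
  inverses are enough, and the quotient is the group presented by these relations.
\<close>
inductive coxeter_congruent :: "('a, 'b) monoid_scheme \<Rightarrow> 'a set \<Rightarrow> 'a list \<Rightarrow> 'a list \<Rightarrow> bool"
  for G :: "('a, 'b) monoid_scheme" and S :: "'a set" where
  relator: "\<lbrakk>s \<in> S; t \<in> S; set u \<subseteq> S; set v \<subseteq> S\<rbrakk> \<Longrightarrow>
    coxeter_congruent G S (u @ concat (replicate (group.ord G (s \<otimes>\<^bsub>G\<^esub> t)) [s, t]) @ v) (u @ v)"
| refl: "set u \<subseteq> S \<Longrightarrow> coxeter_congruent G S u u"
| sym: "coxeter_congruent G S u v \<Longrightarrow> coxeter_congruent G S v u"
| trans: "coxeter_congruent G S u v \<Longrightarrow> coxeter_congruent G S v w \<Longrightarrow> coxeter_congruent G S u w"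

text \<open>
  The usual (Bourbaki) definition: \<open>S\<close> is a generating set of involutions and the relations
  \<open>(st)\<^bsup>m(s,t)\<^esup> = 1\<close> form a presentation of \<open>G\<close>. In \<open>presentation\<close> only the nontrivial
  implication is required.
\<close>
locale coxeter_system = group G for G :: "('a, 'b) monoid_scheme" (structure) +
  fixes S :: "'a set"
  assumes gens_closed: "S \<subseteq> carrier G"
    and gens_order: "\<And>s. s \<in> S \<Longrightarrow> ord s = 2"
    and gens_generate: "generate G S = carrier G"
    and presentation: "\<And>u v. \<lbrakk>set u \<subseteq> S; set v \<subseteq> S; list_prod G u = list_prod G v\<rbrakk> \<Longrightarrow>
      coxeter_congruent G S u v"

locale finite_coxeter_system = coxeter_system +
  assumes finite_carrier: "finite (carrier G)"

definition conj_by :: "('a, 'b) monoid_scheme \<Rightarrow> 'a \<Rightarrow> 'a \<Rightarrow> 'a" where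
  "conj_by G w x = w \<otimes>\<^bsub>G\<^esub> x \<otimes>\<^bsub>G\<^esub> inv\<^bsub>G\<^esub> w"

definition reflections :: "('a, 'b) monoid_scheme \<Rightarrow> 'a set \<Rightarrow> 'a set" where
  "reflections G S = {conj_by G w s | w s. w \<in> carrier G \<and> s \<in> S}"

text \<open>Word length; words in reflections need no inverses. Only meaningful on \<open>carrier G\<close>.\<close>
definition abs_length :: "('a, 'b) monoid_scheme \<Rightarrow> 'a set \<Rightarrow> 'a \<Rightarrow> nat" where
  "abs_length G S w =
    (LEAST n. \<exists>ts. set ts \<subseteq> reflections G S \<and> length ts = n \<and> list_prod G ts = w)"

definition abs_le :: "('a, 'b) monoid_scheme \<Rightarrow> 'a set \<Rightarrow> 'a \<Rightarrow> 'a \<Rightarrow> bool" where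
  "abs_le G S x y \<longleftrightarrow> abs_length G S y = abs_length G S x + abs_length G S (inv\<^bsub>G\<^esub> x \<otimes>\<^bsub>G\<^esub> y)"

definition coxeter_element :: "('a, 'b) monoid_scheme \<Rightarrow> 'a set \<Rightarrow> 'a \<Rightarrow> bool" where
  "coxeter_element G S c \<longleftrightarrow>
    (\<exists>w\<in>carrier G. \<exists>xs. distinct xs \<and> set xs = S \<and> c = conj_by G w (list_prod G xs))"

definition parabolic_subgroup :: "('a, 'b) monoid_scheme \<Rightarrow> 'a set \<Rightarrow> 'a set \<Rightarrow> 'a set \<Rightarrow> bool" where
  "parabolic_subgroup G S H S' \<longleftrightarrow>
    (\<exists>I w. I \<subseteq> S \<and> w \<in> carrier G \<and> H = conj_by G w ` generate G I \<and> S' = conj_by G w ` I)"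

definition NC :: "('a, 'b) monoid_scheme \<Rightarrow> 'a set \<Rightarrow> 'a \<Rightarrow> 'a set" where
  "NC G S c = {w \<in> carrier G. abs_le G S \<one>\<^bsub>G\<^esub> w \<and> abs_le G S w c}"

text \<open>
  A \<open>k\<close>-tuple is an extensional function on \<open>{1..k}\<close>. For a tuple \<open>p\<close> the function
  \<open>p(Suc k := c)\<close> encodes the convention that the entry of index \<open>k + 1\<close> is \<open>c\<close>.
\<close>

definition delta :: "('a, 'b) monoid_scheme \<Rightarrow> 'a \<Rightarrow> nat \<Rightarrow> (nat \<Rightarrow> 'a) \<Rightarrow> (nat \<Rightarrow> 'a)" where
  "delta G c k p = (\<lambda>i\<in>{1..k}. inv\<^bsub>G\<^esub> (p i) \<otimes>\<^bsub>G\<^esub> (p(Suc k := c)) (Suc i))"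

definition multichains :: "('a, 'b) monoid_scheme \<Rightarrow> 'a set \<Rightarrow> 'a \<Rightarrow> nat \<Rightarrow> (nat \<Rightarrow> 'a) set" where
  "multichains G S c k =
    {p \<in> {1..k} \<rightarrow>\<^sub>E NC G S c. \<forall>i\<in>{1..<k}. abs_le G S (p i) (p (Suc i))}"

definition componentwise_le ::
  "('a, 'b) monoid_scheme \<Rightarrow> 'a set \<Rightarrow> nat \<Rightarrow> (nat \<Rightarrow> 'a) \<Rightarrow> (nat \<Rightarrow> 'a) \<Rightarrow> bool" where
  "componentwise_le G S k d e \<longleftrightarrow> (\<forall>i\<in>{1..k}. abs_le G S (d i) (e i))"

definition multichain_le ::
  "('a, 'b) monoid_scheme \<Rightarrow> 'a set \<Rightarrow> 'a \<Rightarrow> nat \<Rightarrow> (nat \<Rightarrow> 'a) \<Rightarrow> (nat \<Rightarrow> 'a) \<Rightarrow> bool" where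
  "multichain_le G S c k p q \<longleftrightarrow> componentwise_le G S k (delta G c k q) (delta G c k p)"

definition delta_sequences :: "('a, 'b) monoid_scheme \<Rightarrow> 'a set \<Rightarrow> 'a \<Rightarrow> nat \<Rightarrow> (nat \<Rightarrow> 'a) set" where
  "delta_sequences G S c k =
    {d \<in> {1..k} \<rightarrow>\<^sub>E NC G S c.
      let d0 = c \<otimes>\<^bsub>G\<^esub> inv\<^bsub>G\<^esub> (list_prod G (map d [1..<Suc k]))
      in abs_length G S c = abs_length G S d0 + (\<Sum>i=1..k. abs_length G S (d i))}"

definition poset_iso ::
  "('c \<Rightarrow> 'd) \<Rightarrow> 'c set \<Rightarrow> ('c \<Rightarrow> 'c \<Rightarrow> bool) \<Rightarrow> 'd set \<Rightarrow> ('d \<Rightarrow> 'd \<Rightarrow> bool) \<Rightarrow> bool" where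
  "poset_iso f A leA B leB \<longleftrightarrow>
    bij_betw f A B \<and> (\<forall>x\<in>A. \<forall>y\<in>A. leA x y \<longleftrightarrow> leB (f x) (f y))"

end

theory Submission
  imports Defs
begin

text \<open>
  Write \<open>T\<close> for the reflections, \<open>L\<close> for the length with respect to \<open>T\<close>, and \<open>N(w)\<close> for the set of
  inversions of \<open>w\<close>, that is, of the reflections \<open>t\<close> such that \<open>w t\<close> is shorter than \<open>w\<close> in the
  generators \<open>S\<close>.

  The parabolic subgroup \<open>H\<close> enters through one property: a shortest word in reflections for an
  element of \<open>H\<close> has all its letters in \<open>H\<close> (\<open>reduced_reflection_word_in_parabolic\<close>). It implies that the
  two reflection lengths agree on \<open>H\<close>, and that everything below an element of \<open>H\<close> in the absolute
  order lies in \<open>H\<close>. Hence multichains and delta sequences of \<open>H\<close> for its Coxeter element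
  \<open>\<pi>\<^sub>1\<close> are the same as those of \<open>G\<close> below \<open>\<pi>\<^sub>1\<close>, with the same orders, and \<open>H\<close> disappears
  from the theorem.

  The property is proved without a geometric representation. Let \<open>w\<close> be in a standard parabolic
  subgroup and let \<open>w = t\<^sub>1 \<dots> t\<^sub>n\<close> be shortest. If the lengths (in \<open>S\<close>) of the prefixes
  \<open>t\<^sub>1 \<dots> t\<^sub>i\<close> increase, then the strong exchange property applied to the last letter shows that
  \<open>t\<^sub>n\<close> and \<open>w t\<^sub>n\<close> lie in the subgroup, and one continues downwards. If the lengths have a
  peak, the two neighbouring letters \<open>t, t'\<close> there can be replaced by two other reflections with the same
  product that generate the same subgroup, so that the prefix at the peak becomes shorter
  (\<open>lower_peak\<close>); after finitely many replacements no peak is left. A peak can be lowered because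
  otherwise \<open>t t' \<noteq> 1\<close> would have no inversion among the reflections
  \<open>(t t')\<^sup>j t\<close>, and \<open>no_inversions_in_reflection_set\<close> excludes that. The strong exchange
  property comes from the presentation: the parity with which a reflection occurs in the list of
  inversions of a word is the same for all words of an element.

  Below \<open>\<pi>\<^sub>1\<close> the theorem is a count of lengths. \<open>L\<close> is subadditive and invariant under conjugation.
  With \<open>a\<^sub>i = \<pi>\<^sub>1\<^sup>-\<^sup>1 \<pi>\<^sub>i\<close> the map of part (2) sends \<open>\<epsilon>\<^sub>i\<close> to
  \<open>a\<^sub>i (\<epsilon>\<^sub>i \<delta>\<^sub>i\<^sup>-\<^sup>1) a\<^sub>i\<^sup>-\<^sup>1\<close>. This leaves \<open>\<epsilon>\<^sub>0\<close> unchanged, and if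
  \<open>\<delta>\<^sub>i \<le> \<epsilon>\<^sub>i\<close> it lowers the length of entry \<open>i\<close> by exactly \<open>L \<delta>\<^sub>i\<close>; the sum of all these
  differences is \<open>L c - L \<pi>\<^sub>1\<close>. Conversely, if the image has the right total length, subadditivity forces
  \<open>\<delta>\<^sub>i \<le> \<epsilon>\<^sub>i\<close> for all \<open>i\<close>. Part (1) follows, because passing to delta sequences turns
  the map of part (1) into the map of part (2).
\<close>

section \<open>Words, conjugation and inversion counts\<close>

context group
begin

lemma inv_mult_cancel [simp]:
  assumes "x \<in> carrier G" "y \<in> carrier G"
  shows "inv x \<otimes> (x \<otimes> y) = y" "x \<otimes> (inv x \<otimes> y) = y"
  using assms by (simp_all flip: m_assoc)

lemma list_prod_Nil [simp]: "list_prod G [] = \<one>"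
  by (simp add: list_prod_def)

lemma list_prod_Cons [simp]: "list_prod G (x # xs) = x \<otimes> list_prod G xs"
  by (simp add: list_prod_def)

lemma list_prod_closed [simp]: "set xs \<subseteq> carrier G \<Longrightarrow> list_prod G xs \<in> carrier G"
  by (induction xs) auto

lemma list_prod_append [simp]:
  "set xs \<subseteq> carrier G \<Longrightarrow> set ys \<subseteq> carrier G \<Longrightarrow>
    list_prod G (xs @ ys) = list_prod G xs \<otimes> list_prod G ys"
  by (induction xs) (auto simp: m_assoc)

lemma list_prod_in_subgroup:
  assumes "subgroup K G" "set xs \<subseteq> K" shows "list_prod G xs \<in> K"
  using assms(2)
  by (induction xs) (auto intro: subgroup.m_closed[OF assms(1)] subgroup.one_closed[OF assms(1)])

lemma conj_by_closed [simp]: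
  "w \<in> carrier G \<Longrightarrow> x \<in> carrier G \<Longrightarrow> conj_by G w x \<in> carrier G"
  by (simp add: conj_by_def)

lemma conj_by_one [simp]: "x \<in> carrier G \<Longrightarrow> conj_by G \<one> x = x"
  by (simp add: conj_by_def)

lemma conj_by_one_right [simp]: "w \<in> carrier G \<Longrightarrow> conj_by G w \<one> = \<one>"
  by (simp add: conj_by_def)

lemma conj_by_mult:
  "v \<in> carrier G \<Longrightarrow> w \<in> carrier G \<Longrightarrow> x \<in> carrier G \<Longrightarrow>
    conj_by G (v \<otimes> w) x = conj_by G v (conj_by G w x)"
  by (simp add: conj_by_def inv_mult_group m_assoc)

lemma conj_by_mult_right:
  "w \<in> carrier G \<Longrightarrow> x \<in> carrier G \<Longrightarrow> y \<in> carrier G \<Longrightarrow>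
    conj_by G w (x \<otimes> y) = conj_by G w x \<otimes> conj_by G w y"
  by (simp add: conj_by_def m_assoc)

lemma conj_by_inv_right:
  "w \<in> carrier G \<Longrightarrow> x \<in> carrier G \<Longrightarrow> conj_by G w (inv x) = inv (conj_by G w x)"
  by (simp add: conj_by_def m_assoc inv_mult_group)

lemma conj_by_conj_by:
  "w \<in> carrier G \<Longrightarrow> a \<in> carrier G \<Longrightarrow> b \<in> carrier G \<Longrightarrow>
    conj_by G w (conj_by G a b) = conj_by G (conj_by G w a) (conj_by G w b)"
  by (simp add: conj_by_def m_assoc inv_mult_group)

lemma conj_by_inverse [simp]:
  assumes "w \<in> carrier G" "x \<in> carrier G"
  shows "conj_by G (inv w) (conj_by G w x) = x" "conj_by G w (conj_by G (inv w) x) = x"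
  using assms by (simp_all flip: conj_by_mult)

lemma list_prod_map_conj_by:
  assumes "w \<in> carrier G" "set xs \<subseteq> carrier G"
  shows "list_prod G (map (conj_by G w) xs) = conj_by G w (list_prod G xs)"
  using assms(2) by (induction xs) (auto simp: assms(1) conj_by_mult_right)

lemma list_prod_concat_replicate:
  assumes "s \<in> carrier G" "t \<in> carrier G"
  shows "list_prod G (concat (replicate n [s, t])) = (s \<otimes> t) [^] n"
proof (induction n)
  case (Suc n)
  have "list_prod G (concat (replicate (Suc n) [s, t])) = (s \<otimes> t) \<otimes> (s \<otimes> t) [^] n"
    using Suc assms by (simp add: m_assoc)
  then show ?case using assms by (simp only: nat_pow_Suc2 m_closed)
qed simp

lemma involution_iff_inv:
  "x \<in> carrier G \<Longrightarrow> x \<otimes> x = \<one> \<longleftrightarrow> inv x = x"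
  by (metis inv_equality r_inv)

text \<open>
  Both factors of a product of two involutions invert it, since conjugation by either one exchanges
  \<open>s t\<close> and \<open>t s\<close>.
\<close>
lemma involution_pow_swap:
  assumes s: "s \<in> carrier G" "s \<otimes> s = \<one>" and t: "t \<in> carrier G" "t \<otimes> t = \<one>"
  shows "t \<otimes> (s \<otimes> t) [^] (n::nat) = inv ((s \<otimes> t) [^] n) \<otimes> t"
proof (induction n)
  case (Suc n)
  have inv: "inv (s \<otimes> t) = t \<otimes> s"
    using s t by (simp add: inv_mult_group involution_iff_inv)
  have "t \<otimes> (s \<otimes> t) [^] Suc n = t \<otimes> (s \<otimes> t) [^] n \<otimes> (s \<otimes> t)"
    using s t by (simp add: m_assoc)
  also have "\<dots> = inv ((s \<otimes> t) [^] n) \<otimes> inv (s \<otimes> t) \<otimes> t"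
    using s t by (simp only: Suc inv) (simp add: m_assoc)
  also have "inv ((s \<otimes> t) [^] n) \<otimes> inv (s \<otimes> t) = inv ((s \<otimes> t) [^] Suc n)"
    using s t by (simp only: nat_pow_Suc2 inv_mult_group m_closed nat_pow_closed)
  finally show ?case .
qed (use t in simp)

lemma involution_int_pow_swap:
  assumes s: "s \<in> carrier G" "s \<otimes> s = \<one>" and t: "t \<in> carrier G" "t \<otimes> t = \<one>"
  shows "s \<otimes> (s \<otimes> t) [^] (j::int) = (s \<otimes> t) [^] (- j) \<otimes> s"
proof -
  have pos: "s \<otimes> (s \<otimes> t) [^] n = inv ((s \<otimes> t) [^] n) \<otimes> s" for n :: nat
  proof -
    have "s \<otimes> (s \<otimes> t) [^] n = s \<otimes> (t \<otimes> (t \<otimes> (s \<otimes> t) [^] n))"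
      using s t by (simp flip: m_assoc)
    also have "\<dots> = s \<otimes> (t \<otimes> (inv ((s \<otimes> t) [^] n) \<otimes> t))"
      by (simp only: involution_pow_swap[OF assms])
    also have "\<dots> = (s \<otimes> t) \<otimes> inv ((s \<otimes> t) [^] n) \<otimes> (t \<otimes> s) \<otimes> s"
      using s t by (simp add: m_assoc)
    also have "t \<otimes> s = inv (s \<otimes> t)"
      using s t by (simp add: inv_mult_group involution_iff_inv)
    also have "(s \<otimes> t) \<otimes> inv ((s \<otimes> t) [^] n) \<otimes> inv (s \<otimes> t) = inv ((s \<otimes> t) [^] n)"
    proof -
      have "(s \<otimes> t) \<otimes> inv ((s \<otimes> t) [^] n) = inv ((s \<otimes> t) [^] n) \<otimes> (s \<otimes> t)"
        using s t int_pow_mult[of "s \<otimes> t" 1 "- int n"] int_pow_mult[of "s \<otimes> t" "- int n" 1]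
        by (simp add: int_pow_neg int_pow_int add.commute)
      then show ?thesis using s t by (simp add: m_assoc)
    qed
    finally show ?thesis .
  qed
  show ?thesis
  proof (cases j rule: int_cases2)
    case (nonneg n)
    then show ?thesis using pos[of n] s t by (simp add: int_pow_int int_pow_neg)
  next
    case (nonpos n)
    have "s \<otimes> inv ((s \<otimes> t) [^] n) = (s \<otimes> t) [^] n \<otimes> s"
    proof -
      have "(s \<otimes> t) [^] n \<otimes> s = (s \<otimes> s) \<otimes> (s \<otimes> t) [^] n \<otimes> s"
        using s t by simp
      also have "\<dots> = s \<otimes> (s \<otimes> (s \<otimes> t) [^] n) \<otimes> s"
        using s t by (simp flip: m_assoc)
      also have "\<dots> = s \<otimes> inv ((s \<otimes> t) [^] n)"
        using s t by (simp only: pos) (simp add: m_assoc)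
      finally show ?thesis by simp
    qed
    then show ?thesis using nonpos s t by (simp add: int_pow_int int_pow_neg)
  qed
qed

text \<open>
  In a word of involutions \<open>s\<^sub>1 \<dots> s\<^sub>m\<close> the letter in position \<open>i\<close> gives the element
  \<open>(s\<^sub>i\<^sub>+\<^sub>1 \<dots> s\<^sub>m)\<^sup>-\<^sup>1 s\<^sub>i (s\<^sub>i\<^sub>+\<^sub>1 \<dots> s\<^sub>m)\<close>; right multiplication by it deletes that letter. The
  function counts the positions that give \<open>x\<close>.
\<close>
primrec inversion_count :: "'a list \<Rightarrow> 'a \<Rightarrow> nat" where
  "inversion_count [] x = 0"
| "inversion_count (s # u) x =
    of_bool (x = conj_by G (inv (list_prod G u)) s) + inversion_count u x"

lemma conj_by_eq_iff:
  "w \<in> carrier G \<Longrightarrow> x \<in> carrier G \<Longrightarrow> y \<in> carrier G \<Longrightarrow>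
    x = conj_by G (inv w) y \<longleftrightarrow> conj_by G w x = y"
  by auto

text \<open>
  The cocycle identity behind everything that follows: letters of \<open>u\<close> contribute to \<open>u v\<close> the conjugates
  of their contributions to \<open>u\<close>.
\<close>
lemma inversion_count_append:
  assumes "set u \<subseteq> carrier G" "set v \<subseteq> carrier G" "x \<in> carrier G"
  shows "inversion_count (u @ v) x =
    inversion_count u (conj_by G (list_prod G v) x) + inversion_count v x"
  using assms by (induction u) (auto simp: conj_by_eq_iff conj_by_mult)

text \<open>
  Read from the right, the alternating word gives \<open>t, t s t, t s t s t, \<dots>\<close>, and the entry of
  index \<open>i\<close> is \<open>(s t)\<^sup>-\<^sup>i t\<close>.
\<close>
lemma inversion_count_alternating:
  assumes s: "s \<in> carrier G" "s \<otimes> s = \<one>" and t: "t \<in> carrier G" "t \<otimes> t = \<one>"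
    and x: "x \<in> carrier G"
  shows "inversion_count (concat (replicate n [s, t])) x =
    (\<Sum>i<2 * n. of_bool (x = inv ((s \<otimes> t) [^] i) \<otimes> t))"
proof (induction n)
  case (Suc n)
  define q where "q = (s \<otimes> t) [^] n"
  have q: "q \<in> carrier G" "t \<otimes> q = inv q \<otimes> t"
    using s t involution_pow_swap[OF s t] by (simp_all add: q_def)
  have qq: "(s \<otimes> t) [^] (2 * n) = q \<otimes> q"
    using s t by (simp add: q_def mult_2 nat_pow_mult)
  have "conj_by G q x = t \<longleftrightarrow> x = conj_by G (inv q) t"
    using q s t x by auto
  moreover have "conj_by G (inv q) t = inv ((s \<otimes> t) [^] (2 * n)) \<otimes> t"
    using q s t by (simp add: conj_by_def qq inv_mult_group m_assoc)
  moreover have "conj_by G q x = conj_by G (inv t) s \<longleftrightarrow> x = conj_by G (inv q) (conj_by G (inv t) s)"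
    using q s t x by (subst conj_by_eq_iff) auto
  moreover have "conj_by G (inv q) (conj_by G (inv t) s) = inv ((s \<otimes> t) [^] Suc (2 * n)) \<otimes> t"
  proof -
    have "conj_by G (inv q) (conj_by G (inv t) s) = inv q \<otimes> t \<otimes> s \<otimes> (t \<otimes> q)"
      using q(1) s t by (simp add: conj_by_def involution_iff_inv m_assoc)
    also have "\<dots> = inv q \<otimes> inv (q \<otimes> (s \<otimes> t)) \<otimes> t"
      using q(1) s t by (simp only: q(2)) (simp add: involution_iff_inv inv_mult_group m_assoc)
    also have "inv q \<otimes> inv (q \<otimes> (s \<otimes> t)) = inv ((s \<otimes> t) [^] Suc (2 * n))"
    proof -
      have "(s \<otimes> t) [^] Suc (2 * n) = q \<otimes> (s \<otimes> t) \<otimes> q"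
      proof -
        have "(s \<otimes> t) [^] Suc (2 * n) = (s \<otimes> t) [^] Suc n \<otimes> (s \<otimes> t) [^] n"
          using s t by (subst nat_pow_mult) (simp_all add: mult_2)
        then show ?thesis using s t by (simp only: q_def nat_pow_Suc)
      qed
      then show ?thesis using q s t by (simp add: inv_mult_group)
    qed
    finally show ?thesis .
  qed
  ultimately have "inversion_count [s, t] (conj_by G q x) =
      of_bool (x = inv ((s \<otimes> t) [^] Suc (2 * n)) \<otimes> t) + of_bool (x = inv ((s \<otimes> t) [^] (2 * n)) \<otimes> t)"
    using q s t x by simp
  moreover have "inversion_count (concat (replicate (Suc n) [s, t])) x =
      inversion_count [s, t] (conj_by G q x) + inversion_count (concat (replicate n [s, t])) x"
  proof -
    have "set (concat (replicate n [s, t])) \<subseteq> carrier G" using s t by auto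
    then show ?thesis
      using inversion_count_append[of "[s, t]" "concat (replicate n [s, t])" x] s t x
      by (simp add: list_prod_concat_replicate q_def del: inversion_count.simps)
  qed
  ultimately show ?case using Suc by simp
qed simp

text \<open>
  In a relator \<open>(s t)\<^sup>m\<close> the sequence \<open>(s t)\<^sup>-\<^sup>i t\<close> runs over \<open>i < 2 m\<close> and has period \<open>m\<close>, so
  every value occurs an even number of times.
\<close>
lemma even_inversion_count_relator:
  assumes s: "s \<in> carrier G" "s \<otimes> s = \<one>" and t: "t \<in> carrier G" "t \<otimes> t = \<one>"
    and x: "x \<in> carrier G"
  shows "even (inversion_count (concat (replicate (ord (s \<otimes> t)) [s, t])) x)"
proof -
  define m where "m = ord (s \<otimes> t)"
  have m: "(s \<otimes> t) [^] m = \<one>" using s t by (simp add: m_def)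
  have pow: "(s \<otimes> t) [^] (m + i) = (s \<otimes> t) [^] i" for i
    using s t m by (simp flip: nat_pow_mult)
  define f where "f i = (of_bool (x = inv ((s \<otimes> t) [^] i) \<otimes> t) :: nat)" for i :: nat
  have f: "f (i + m) = f i" for i using pow[of i] by (simp add: f_def add.commute)
  have "(\<Sum>i<m + m. f i) = (\<Sum>i<m. f i) + (\<Sum>i<m. f i)"
  proof -
    have "(\<Sum>i<m + m. f i) = (\<Sum>i\<in>{0..<m}. f i) + (\<Sum>i\<in>{m..<m+m}. f i)"
      unfolding lessThan_atLeast0 by (rule sum.atLeastLessThan_concat[symmetric]) simp_all
    also have "(\<Sum>i\<in>{m..<m+m}. f i) = (\<Sum>i\<in>{0..<m}. f i)"
      using sum.shift_bounds_nat_ivl[of f 0 m m] by (simp add: f)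
    finally show ?thesis by (simp add: lessThan_atLeast0)
  qed
  then show ?thesis
    using inversion_count_alternating[OF s t x, of m] by (simp add: m_def f_def mult_2)
qed

end

section \<open>Inversions and the strong exchange property\<close>

context group
begin

text \<open>
  The exchange property for arbitrary words of involutions. It will be applied to shortest words, and also
  to words in the generators of a parabolic subgroup; the latter locate inversions in the subgroup.
\<close>
lemma inversion_count_pos:
  assumes "set u \<subseteq> carrier G" "\<And>s. s \<in> set u \<Longrightarrow> s \<otimes> s = \<one>" "inversion_count u x > 0"
  shows "\<exists>s v. s \<in> set u \<and> set v \<subseteq> set u \<and> x = conj_by G (inv (list_prod G v)) s \<and>
    (\<exists>v'. set v' \<subseteq> set u \<and> length v' < length u \<and> list_prod G u \<otimes> x = list_prod G v')"
  using assms
proof (induction u)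
  case (Cons s u)
  show ?case
  proof (cases "x = conj_by G (inv (list_prod G u)) s")
    case True
    have "list_prod G (s # u) \<otimes> x = (s \<otimes> s) \<otimes> list_prod G u"
      using Cons.prems(1) by (simp add: True conj_by_def m_assoc)
    then have "list_prod G (s # u) \<otimes> x = list_prod G u"
      using Cons.prems(1,2) by simp
    then show ?thesis using True by (intro exI[of _ s] exI[of _ u]) auto
  next
    case False
    then obtain s' v v' where *: "s' \<in> set u" "set v \<subseteq> set u" "x = conj_by G (inv (list_prod G v)) s'"
      "set v' \<subseteq> set u" "length v' < length u" "list_prod G u \<otimes> x = list_prod G v'"
      using Cons by fastforce
    then have "list_prod G v \<in> carrier G" "s' \<in> carrier G"
      using Cons.prems(1) by (auto intro!: list_prod_closed)
    then have x: "x \<in> carrier G" using *(3) by simp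
    have "list_prod G (s # u) \<otimes> x = list_prod G (s # v')"
      using *(6) x Cons.prems(1) by (simp add: m_assoc)
    moreover have "set (s # v') \<subseteq> set (s # u)" "length (s # v') < length (s # u)"
      using *(4,5) by auto
    ultimately show ?thesis using *(1-3)
      by (metis list.set_intros(2) set_subset_Cons subset_trans)
  qed
qed simp

end

context coxeter_system
begin

abbreviation "T \<equiv> reflections G S"

lemma gens_in_carrier [simp]: "s \<in> S \<Longrightarrow> s \<in> carrier G"
  using gens_closed by blast

lemma gens_involution [simp]: "s \<in> S \<Longrightarrow> s \<otimes> s = \<one>"
  using pow_ord_eq_1[of s] by (simp add: gens_order numeral_2_eq_2)

lemma gens_inv [simp]: "s \<in> S \<Longrightarrow> inv s = s"
  by (metis gens_in_carrier gens_involution involution_iff_inv)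

lemma word_closed: "set u \<subseteq> S \<Longrightarrow> set u \<subseteq> carrier G"
  using gens_closed by blast

lemma generate_iff_word:
  assumes "I \<subseteq> S"
  shows "w \<in> generate G I \<longleftrightarrow> (\<exists>u. set u \<subseteq> I \<and> list_prod G u = w)"
proof
  assume "w \<in> generate G I"
  then show "\<exists>u. set u \<subseteq> I \<and> list_prod G u = w"
  proof (induction rule: generate.induct)
    case one
    show ?case by (rule exI[of _ "[]"]) simp
  next
    case (incl h)
    then show ?case using assms by (intro exI[of _ "[h]"]) auto
  next
    case (inv h)
    then have "inv h = h" using assms by (intro gens_inv) auto
    then show ?case using assms inv by (intro exI[of _ "[h]"]) auto
  next
    case (eng h1 h2)
    then obtain u v where "set u \<subseteq> I" "list_prod G u = h1" "set v \<subseteq> I" "list_prod G v = h2" by blast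
    then show ?case using assms word_closed by (intro exI[of _ "u @ v"]) auto
  qed
next
  assume "\<exists>u. set u \<subseteq> I \<and> list_prod G u = w"
  then show "w \<in> generate G I"
    using list_prod_in_subgroup[OF generate_is_subgroup[of I]] generate.incl[of _ I G] assms gens_closed
    by blast
qed

lemma word_exists: "w \<in> carrier G \<Longrightarrow> \<exists>u. set u \<subseteq> S \<and> list_prod G u = w"
  using generate_iff_word[of S w] gens_generate by simp

text \<open>
  Inserting a relator adds an even number to the count and does not change the count of the other letters.
  With the presentation, the parity therefore depends on the element only.
\<close>
lemma inversion_parity_congruent:
  assumes "coxeter_congruent G S u v" "x \<in> carrier G"
  shows "even (inversion_count u x) = even (inversion_count v x)"
  using assms
proof (induction rule: coxeter_congruent.induct)
  case (relator s t u v)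
  let ?r = "concat (replicate (ord (s \<otimes> t)) [s, t])"
  have [simp]: "set u \<subseteq> carrier G" "set v \<subseteq> carrier G" "s \<in> carrier G" "t \<in> carrier G"
    using relator word_closed by auto
  then have r: "set ?r \<subseteq> carrier G" by auto
  have "list_prod G ?r = \<one>" by (simp add: list_prod_concat_replicate)
  then have "inversion_count (u @ ?r @ v) x =
      inversion_count (u @ v) x + inversion_count ?r (conj_by G (list_prod G v) x)"
    using relator r by (simp add: inversion_count_append)
  moreover have "even (inversion_count ?r (conj_by G (list_prod G v) x))"
    using relator by (intro even_inversion_count_relator) simp_all
  ultimately show ?case by simp
qed simp_all

text \<open>
  The odd counts and not the positive ones: only the parity is independent of the word. The elements turn out
  to be the reflections that shorten \<open>w\<close>.
\<close>
definition inversions :: "'a \<Rightarrow> 'a set" where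
  "inversions w = {x \<in> carrier G. \<exists>u. set u \<subseteq> S \<and> list_prod G u = w \<and> odd (inversion_count u x)}"

lemma inversions_word:
  assumes "set u \<subseteq> S" "x \<in> carrier G"
  shows "x \<in> inversions (list_prod G u) \<longleftrightarrow> odd (inversion_count u x)"
  using assms inversion_parity_congruent[OF presentation]
  unfolding inversions_def by blast

lemma inversions_one [simp]: "inversions \<one> = {}"
  using inversions_word[of "[]"] by (auto simp: inversions_def)

lemma inversions_gen: "s \<in> S \<Longrightarrow> inversions s = {s}"
  using inversions_word[of "[s]"] by (auto simp: inversions_def split: if_splits)

lemma inversions_mult:
  assumes "a \<in> carrier G" "b \<in> carrier G" "x \<in> carrier G"
  shows "x \<in> inversions (a \<otimes> b) \<longleftrightarrow> (x \<in> inversions b) \<noteq> (conj_by G b x \<in> inversions a)"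
proof -
  obtain u v where u: "set u \<subseteq> S" "list_prod G u = a" and v: "set v \<subseteq> S" "list_prod G v = b"
    using assms word_exists by blast
  have "x \<in> inversions (list_prod G (u @ v)) \<longleftrightarrow> odd (inversion_count (u @ v) x)"
    using u v assms by (intro inversions_word) auto
  also have "\<dots> \<longleftrightarrow> (x \<in> inversions b) \<noteq> (conj_by G b x \<in> inversions a)"
    using inversions_word[OF u(1), of "conj_by G b x"] inversions_word[OF v(1), of x] u v assms word_closed
    by (auto simp: inversion_count_append)
  finally show ?thesis using u v word_closed by simp
qed

lemma reflectionE:
  assumes "t \<in> T" obtains w s where "w \<in> carrier G" "s \<in> S" "t = conj_by G w s"
  using assms unfolding reflections_def by blast

lemma reflection_closed [simp]: "t \<in> T \<Longrightarrow> t \<in> carrier G"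
  by (erule reflectionE) simp

lemma reflection_involution [simp]: "t \<in> T \<Longrightarrow> t \<otimes> t = \<one>"
proof -
  assume "t \<in> T"
  then obtain w s where "w \<in> carrier G" "s \<in> S" "t = conj_by G w s"
    by (blast elim: reflectionE)
  moreover from this have "conj_by G w s \<otimes> conj_by G w s = conj_by G w (s \<otimes> s)"
    by (intro conj_by_mult_right[symmetric]) auto
  ultimately show "t \<otimes> t = \<one>" by simp
qed

lemma reflection_inv [simp]: "t \<in> T \<Longrightarrow> inv t = t"
  by (metis reflection_closed reflection_involution involution_iff_inv)

lemma gen_reflection: "s \<in> S \<Longrightarrow> s \<in> T"
  unfolding reflections_def by (intro CollectI exI[of _ \<one>] exI[of _ s]) simp

lemma reflection_conj [simp]: "w \<in> carrier G \<Longrightarrow> t \<in> T \<Longrightarrow> conj_by G w t \<in> T"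
proof -
  assume w: "w \<in> carrier G" and "t \<in> T"
  then obtain v s where "v \<in> carrier G" "s \<in> S" "t = conj_by G v s"
    by (blast elim: reflectionE)
  moreover from this w have "conj_by G w t = conj_by G (w \<otimes> v) s" by (simp add: conj_by_mult)
  ultimately show ?thesis using w unfolding reflections_def by blast
qed

text \<open>
  For \<open>t = w s w\<^sup>-\<^sup>1\<close> the contributions of \<open>w\<close> and of \<open>w\<^sup>-\<^sup>1\<close> to the parity cancel, and the middle
  letter \<open>s\<close> remains.
\<close>
lemma reflection_mem_inversions:
  assumes "t \<in> T" shows "t \<in> inversions t"
proof -
  obtain w s where ws: "w \<in> carrier G" "s \<in> S" "t = conj_by G w s"
    using assms by (blast elim: reflectionE)
  have t: "t = w \<otimes> (s \<otimes> inv w)" using ws by (simp add: conj_by_def m_assoc)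
  have c1: "conj_by G (inv w) t = s" using ws by simp
  have "t \<in> inversions (inv w) \<longleftrightarrow> s \<in> inversions w"
    using inversions_mult[of w "inv w" t] ws c1 by simp
  moreover have "t \<in> inversions (s \<otimes> inv w) \<longleftrightarrow> (t \<in> inversions (inv w)) \<noteq> (s \<in> inversions s)"
    using inversions_mult[of s "inv w" t] ws c1 by simp
  moreover have "conj_by G (s \<otimes> inv w) t = s"
    using ws by (simp add: conj_by_mult) (simp add: conj_by_def)
  then have "t \<in> inversions t \<longleftrightarrow> (t \<in> inversions (s \<otimes> inv w)) \<noteq> (s \<in> inversions w)"
    using inversions_mult[of w "s \<otimes> inv w" t] ws by (simp flip: t)
  ultimately show ?thesis using ws(2) inversions_gen by auto
qed

definition word_length :: "'a \<Rightarrow> nat" where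
  "word_length w = (LEAST n. \<exists>u. set u \<subseteq> S \<and> length u = n \<and> list_prod G u = w)"

lemma word_length_le: "set u \<subseteq> S \<Longrightarrow> word_length (list_prod G u) \<le> length u"
  unfolding word_length_def by (rule Least_le) blast

lemma shortest_word:
  assumes "w \<in> carrier G"
  obtains u where "set u \<subseteq> S" "length u = word_length w" "list_prod G u = w"
proof -
  have "\<exists>n u. set u \<subseteq> S \<and> length u = n \<and> list_prod G u = w" using word_exists[OF assms] by blast
  from LeastI_ex[OF this] show thesis using that unfolding word_length_def by blast
qed

lemma word_length_one [simp]: "word_length \<one> = 0"
  using word_length_le[of "[]"] by simp

lemma word_length_decrease:
  assumes "w \<in> carrier G" "x \<in> inversions w"
  shows "word_length (w \<otimes> x) < word_length w"
proof -
  obtain u where u: "set u \<subseteq> S" "length u = word_length w" "list_prod G u = w"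
    using assms shortest_word by blast
  have "x \<in> carrier G" using assms by (simp add: inversions_def)
  then have "inversion_count u x > 0" using inversions_word[OF u(1)] u(3) assms(2) by (auto intro: odd_pos)
  then obtain v where "set v \<subseteq> set u" "length v < length u" "list_prod G u \<otimes> x = list_prod G v"
    using inversion_count_pos[of u x] u(1) word_closed by (metis gens_involution subsetD)
  then show ?thesis using word_length_le[of v] u by fastforce
qed

text \<open>
  An inversion shortens by the exchange property. If \<open>t\<close> is not an inversion of \<open>w\<close>, then it is one
  of \<open>w t\<close> by the cocycle identity, and the first case applies to \<open>w t\<close>; in particular the lengths of \<open>w\<close>
  and \<open>w t\<close> always differ.
\<close>
lemma inversion_iff_word_length:
  assumes "w \<in> carrier G" "t \<in> T"
  shows "t \<in> inversions w \<longleftrightarrow> word_length (w \<otimes> t) < word_length w"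
    and "t \<notin> inversions w \<longleftrightarrow> word_length w < word_length (w \<otimes> t)"
proof -
  have "word_length w < word_length (w \<otimes> t)" if "t \<notin> inversions w"
  proof -
    have "conj_by G t t = t" using assms by (simp add: conj_by_def m_assoc)
    then have "t \<in> inversions (w \<otimes> t)"
      using that assms inversions_mult[of w t t] reflection_mem_inversions by simp
    then have "word_length (w \<otimes> t \<otimes> t) < word_length (w \<otimes> t)"
      using assms by (intro word_length_decrease) simp_all
    then show ?thesis using assms by (simp add: m_assoc)
  qed
  then show "t \<in> inversions w \<longleftrightarrow> word_length (w \<otimes> t) < word_length w"
    and "t \<notin> inversions w \<longleftrightarrow> word_length w < word_length (w \<otimes> t)"
    using word_length_decrease[OF assms(1), of t] by force+
qed

text \<open>
  A word in \<open>I\<close> for \<open>w\<close> exhibits every inversion of \<open>w\<close> as a conjugate of a letter. Besides strong exchange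
  inside a parabolic subgroup this shows that its reflections are the conjugates of its own generators.
\<close>
lemma inversion_in_generate:
  assumes "I \<subseteq> S" "w \<in> generate G I" "x \<in> inversions w"
  shows "\<exists>v\<in>generate G I. \<exists>s\<in>I. x = conj_by G v s"
proof -
  obtain u where u: "set u \<subseteq> I" "list_prod G u = w" using generate_iff_word assms by blast
  have "x \<in> carrier G" using assms by (simp add: inversions_def)
  then have "inversion_count u x > 0"
    using inversions_word[of u x] u assms by (auto intro: odd_pos)
  then obtain s v where sv: "s \<in> set u" "set v \<subseteq> set u" "x = conj_by G (inv (list_prod G v)) s"
    using inversion_count_pos[of u x] u assms(1) word_closed
    by (metis gens_involution subset_trans subsetD)
  have "list_prod G v \<in> generate G I" using generate_iff_word sv(2) u(1) assms(1) by blast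
  then have "inv (list_prod G v) \<in> generate G I"
    using generate_m_inv_closed[of I] assms(1) gens_closed by blast
  then show ?thesis using sv u(1) by blast
qed

lemma gens_subgroup: "I \<subseteq> S \<Longrightarrow> subgroup (generate G I) G"
  using generate_is_subgroup gens_closed by blast

lemma conj_in_subgroup:
  "subgroup K G \<Longrightarrow> v \<in> K \<Longrightarrow> s \<in> K \<Longrightarrow> conj_by G v s \<in> K"
  unfolding conj_by_def by (simp add: subgroup.m_closed subgroup.m_inv_closed)

section \<open>Straightening reflection factorizations\<close>

text \<open>
  A weak substitute for the theorem that a reflection subgroup is a Coxeter group. If \<open>R\<close> contains a
  generator \<open>s\<close>, then \<open>v s\<close> has at most the inversion \<open>s\<close> in \<open>R\<close>; as \<open>v s\<close> is itself a reflection in \<open>R\<close> it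
  is its own inversion, so \<open>v s = s\<close>. In general \<open>R\<close> contains some conjugate \<open>w s w\<^sup>-\<^sup>1\<close>, and one conjugates
  \<open>R\<close> and \<open>v\<close> by the letters of \<open>w\<close> one at a time until a generator lies in \<open>R\<close>. Conjugation by a
  generator outside \<open>R\<close> keeps the hypotheses because the only inversion of that generator is itself.
\<close>
lemma no_inversions_in_reflection_set:
  assumes "t \<in> R" "R \<subseteq> T" "\<And>u u'. u \<in> R \<Longrightarrow> u' \<in> R \<Longrightarrow> conj_by G u u' \<in> R"
    and "v \<in> carrier G" "\<And>u. u \<in> R \<Longrightarrow> v \<otimes> u \<in> R" "\<And>u. u \<in> R \<Longrightarrow> conj_by G v u \<in> R"
    and "inversions v \<inter> R = {}"
  shows "v = \<one>"
proof -
  obtain w s0 where ws: "w \<in> carrier G" "s0 \<in> S" "t = conj_by G w s0"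
    using assms(1,2) by (blast elim: reflectionE)
  obtain word where "set word \<subseteq> S" "list_prod G word = w" using word_exists[OF ws(1)] by blast
  then have "conj_by G (list_prod G word) s0 \<in> R" "set word \<subseteq> S" using assms(1) ws(3) by auto
  with assms(2-) show ?thesis
  proof (induction word arbitrary: R v)
    have base: "v = \<one>" if R: "R \<subseteq> T" "s \<in> R" "s \<in> S" "\<And>u u'. u \<in> R \<Longrightarrow> u' \<in> R \<Longrightarrow> conj_by G u u' \<in> R"
      and v: "v \<in> carrier G" "v \<otimes> s \<in> R" "inversions v \<inter> R = {}" for R s v
    proof -
      have "v \<otimes> s \<in> inversions (v \<otimes> s)" using R v by (intro reflection_mem_inversions) auto
      moreover have "conj_by G s (v \<otimes> s) \<notin> inversions v" using R v by blast
      ultimately have "v \<otimes> s \<in> inversions s"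
        using inversions_mult[of v s "v \<otimes> s"] R v by simp
      then have "v \<otimes> s = s" using inversions_gen R by auto
      then show ?thesis using v R by simp
    qed
    {
      case Nil
      then show ?case using base[of R s0 v] ws by auto
    next
      case (Cons s word)
      have s: "s \<in> S" "s \<in> carrier G" using Cons.prems by auto
      show ?case
      proof (cases "s \<in> R")
        case True
        then show ?thesis using base[of R s v] Cons.prems s by auto
      next
        case False
        let ?c = "conj_by G s"
        have cc: "?c (?c x) = x" if "x \<in> carrier G" for x
          using that s conj_by_inverse[of s x] by simp
        have RT: "u \<in> T" "u \<in> carrier G" if "u \<in> R" for u using that Cons.prems(1) by auto
        have conj: "conj_by G (?c a) (?c b) = ?c (conj_by G a b)"
          if "a \<in> carrier G" "b \<in> carrier G" for a b
          using that s conj_by_conj_by[of s a b] by simp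
        have "?c v = \<one>"
        proof (rule Cons.IH)
          show "?c ` R \<subseteq> T" using RT s by auto
          show "conj_by G u u' \<in> ?c ` R" if "u \<in> ?c ` R" "u' \<in> ?c ` R" for u u'
            using that Cons.prems(2) RT conj by auto
          show "?c v \<in> carrier G" using s Cons.prems by simp
          show "?c v \<otimes> u \<in> ?c ` R" if "u \<in> ?c ` R" for u
            using that Cons.prems(3,4) RT s by (auto simp flip: conj_by_mult_right)
          show "conj_by G (?c v) u \<in> ?c ` R" if "u \<in> ?c ` R" for u
            using that Cons.prems(3,5) RT s by (auto simp: conj)
          show "set word \<subseteq> S" using Cons.prems by simp
          have "conj_by G (list_prod G (s # word)) s0 = ?c (conj_by G (list_prod G word) s0)"
            using Cons.prems(8) ws(2) word_closed by (simp add: conj_by_mult)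
          then have "?c (conj_by G (list_prod G (s # word)) s0) = conj_by G (list_prod G word) s0"
            using cc[of "conj_by G (list_prod G word) s0"] Cons.prems(8) ws(2) word_closed by auto
          then show "conj_by G (list_prod G word) s0 \<in> ?c ` R"
            using Cons.prems(7) by (metis imageI)
          show "inversions (?c v) \<inter> ?c ` R = {}"
          proof -
            have "?c x \<notin> inversions (?c v)" if x: "x \<in> R" for x
            proof -
              note v = Cons.prems(3)
              have xc: "x \<in> carrier G" using RT x by simp
              have "x \<notin> inversions v" using x Cons.prems(6) by auto
              \<comment> \<open>Both new contributions to the inversions of \<open>s v s\<close> would force \<open>s \<in> R\<close>.\<close>
              moreover have "conj_by G v x \<noteq> s" using Cons.prems(5)[OF x] False by auto
              ultimately have "x \<notin> inversions (s \<otimes> v)"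
                using inversions_mult[of s v x] xc v s inversions_gen by auto
              moreover have "?c x \<noteq> s"
              proof
                assume "?c x = s"
                then have "x = ?c s" using cc[OF xc] by simp
                then have "x = s" using s by (simp add: conj_by_def)
                then show False using x False by simp
              qed
              ultimately have "?c x \<notin> inversions (s \<otimes> v \<otimes> s)"
                using inversions_mult[of "s \<otimes> v" s "?c x"] xc v s inversions_gen cc by auto
              then show ?thesis using s by (simp add: conj_by_def[of G s v])
            qed
            then show ?thesis by blast
          qed
        qed
        then have "?c (?c v) = ?c \<one>" by simp
        then show ?thesis using cc Cons.prems(3) s by simp
      qed
    }
  qed
qed

text \<open>
  With \<open>r = t1 t2\<close> the reflections \<open>\<rho> j = r\<^sup>j t1\<close> are exactly those that arise by repeated Hurwitz moves,
  \<open>(\<rho> j, \<rho> (j - 1))\<close> being a factorization of \<open>r\<close>. If no \<open>x \<rho> j\<close> were below the peak, then neither \<open>x\<close> nor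
  \<open>x r\<close> would have an inversion among the \<open>\<rho> j\<close>, since both lie below the peak and multiplication by
  \<open>\<rho> j\<close> leads to some \<open>x \<rho> i\<close>. By the cocycle identity \<open>r\<close> would have none either, which gives \<open>r = 1\<close>.
\<close>
lemma lower_peak:
  assumes x: "x \<in> carrier G" and t: "t1 \<in> T" "t2 \<in> T" "t1 \<noteq> t2"
    and peak: "word_length x < word_length (x \<otimes> t1)"
      "word_length (x \<otimes> t1 \<otimes> t2) < word_length (x \<otimes> t1)"
  shows "\<exists>u\<in>T. u \<otimes> (t1 \<otimes> t2) \<in> T \<and> word_length (x \<otimes> u) < word_length (x \<otimes> t1) \<and>
    (\<forall>K. subgroup K G \<longrightarrow> u \<in> K \<longrightarrow> u \<otimes> (t1 \<otimes> t2) \<in> K \<longrightarrow> t1 \<in> K \<and> t2 \<in> K)"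
proof -
  define r where "r = t1 \<otimes> t2"
  have tc: "t1 \<in> carrier G" "t2 \<in> carrier G" "r \<in> carrier G" and tt: "t1 \<otimes> t1 = \<one>" "t2 \<otimes> t2 = \<one>"
    using t by (simp_all add: r_def)
  define \<rho> where "\<rho> j = r [^] j \<otimes> t1" for j :: int
  have pow [simp]: "r [^] j \<in> carrier G" for j :: int using tc by simp
  have \<rho>c [simp]: "\<rho> j \<in> carrier G" for j using tc by (simp add: \<rho>_def)
  have swap: "t1 \<otimes> r [^] j = r [^] (- j) \<otimes> t1" for j :: int
    unfolding r_def using involution_int_pow_swap tc(1,2) tt by blast
  have mult: "r [^] i \<otimes> \<rho> j = \<rho> (i + j)" for i j
    using tc by (simp add: \<rho>_def int_pow_mult m_assoc)
  have mult_right: "\<rho> j \<otimes> r [^] i = \<rho> (j - i)" for i j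
    using tc int_pow_mult[of r j "- i"]
    by (simp add: \<rho>_def m_assoc swap)
  have conj: "conj_by G (r [^] i) (\<rho> j) = \<rho> (2 * i + j)" for i j
  proof -
    have "conj_by G (r [^] i) (\<rho> j) = \<rho> (i + j) \<otimes> r [^] (- i)"
      using tc by (simp add: conj_by_def mult int_pow_neg)
    then show ?thesis by (simp add: mult_right algebra_simps)
  qed
  have conj_t1: "conj_by G t1 (\<rho> j) = \<rho> (- j)" for j
    using tc tt by (simp add: conj_by_def \<rho>_def swap m_assoc involution_iff_inv[THEN iffD1])
  have \<rho>0: "\<rho> 0 = t1" using tc by (simp add: \<rho>_def)
  have "\<rho> 1 = conj_by G t1 t2" using t tc by (simp add: \<rho>_def r_def conj_by_def)
  then have \<rho>1: "\<rho> 1 \<in> T" using t tc by simp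
  have \<rho>T: "\<rho> j \<in> T" for j
  proof (cases "even j")
    case True
    then obtain i where "j = 2 * i" by blast
    then have "\<rho> j = conj_by G (r [^] i) (\<rho> 0)" by (simp add: conj)
    then show ?thesis using \<rho>0 t by simp
  next
    case False
    then obtain i where "j = 2 * i + 1" by (elim oddE)
    then have "\<rho> j = conj_by G (r [^] i) (\<rho> 1)" by (simp add: conj)
    then show ?thesis using \<rho>1 by simp
  qed
  have r1: "r [^] (1::int) = r" using tc by simp
  have "\<exists>j. word_length (x \<otimes> \<rho> j) < word_length (x \<otimes> t1)"
  proof (rule ccontr)
    assume "\<nexists>j. word_length (x \<otimes> \<rho> j) < word_length (x \<otimes> t1)"
    then have min: "word_length (x \<otimes> t1) \<le> word_length (x \<otimes> \<rho> j)" for j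
      by (meson not_le)
    have bottom: "\<rho> j \<notin> inversions x" for j
      using inversion_iff_word_length(2)[OF x \<rho>T] min[of j] peak(1) by simp
    have top: "\<rho> j \<notin> inversions (x \<otimes> r)" for j
    proof -
      have "x \<otimes> r \<otimes> \<rho> j = x \<otimes> \<rho> (1 + j)"
        using mult[of 1 j] r1 x tc by (simp add: m_assoc)
      moreover have "x \<otimes> t1 \<otimes> t2 = x \<otimes> r" using x tc by (simp add: r_def m_assoc)
      ultimately show ?thesis
        using inversion_iff_word_length(2)[of "x \<otimes> r" "\<rho> j", OF _ \<rho>T] min[of "1 + j"] peak(2) x tc
        by simp
    qed
    have "r = \<one>"
    proof (rule no_inversions_in_reflection_set)
      show "t1 \<in> range \<rho>" using \<rho>0 by (metis rangeI)
      show "range \<rho> \<subseteq> T" using \<rho>T by auto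
      show "conj_by G u u' \<in> range \<rho>" if uu: "u \<in> range \<rho>" "u' \<in> range \<rho>" for u u'
      proof -
        obtain i j where ij: "u = \<rho> i" "u' = \<rho> j" using uu by blast
        have "conj_by G u u' = conj_by G (r [^] i) (conj_by G t1 (\<rho> j))"
          using tc by (simp add: ij \<rho>_def[of i] conj_by_mult)
        then show ?thesis by (simp add: conj_t1 conj)
      qed
      show "r \<in> carrier G" by (fact tc)
      show "r \<otimes> u \<in> range \<rho>" if "u \<in> range \<rho>" for u
        using that mult[of 1] r1 by auto
      show "conj_by G r u \<in> range \<rho>" if "u \<in> range \<rho>" for u
        using that conj[of 1] r1 by auto
      have "\<rho> j \<notin> inversions r" for j
        using inversions_mult[of x r "\<rho> j"] x tc bottom[of "2 * 1 + j"] top[of j] conj[of 1 j] r1 by simp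
      then show "inversions r \<inter> range \<rho> = {}" by auto
    qed
    then show False using t tc by (metis inv_equality reflection_inv r_def)
  qed
  then obtain j where j: "word_length (x \<otimes> \<rho> j) < word_length (x \<otimes> t1)" by blast
  have "t1 \<in> K \<and> t2 \<in> K" if K: "subgroup K G" "\<rho> j \<in> K" "\<rho> j \<otimes> r \<in> K" for K
  proof -
    have "inv (\<rho> j) \<otimes> (\<rho> j \<otimes> r) \<in> K" using K by (meson subgroup.m_closed subgroup.m_inv_closed)
    then have rK: "r \<in> K" using tc by simp
    have "r [^] (- j) \<otimes> \<rho> j \<in> K"
      using K rK subgroup_int_pow_closed by (meson subgroup.m_closed)
    then have t1: "t1 \<in> K" using mult[of "- j" j] \<rho>0 by simp
    then have "t1 \<otimes> r \<in> K" using K rK by (meson subgroup.m_closed)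
    moreover have "t1 \<otimes> r = t2" using tc tt by (simp add: r_def flip: m_assoc)
    ultimately show ?thesis using t1 by simp
  qed
  moreover have "\<rho> j \<otimes> r \<in> T" using mult_right[of j 1] r1 \<rho>T by simp
  ultimately show ?thesis using j \<rho>T unfolding r_def by blast
qed

lemma abs_length_le:
  "set ts \<subseteq> T \<Longrightarrow> abs_length G S (list_prod G ts) \<le> length ts"
  unfolding abs_length_def by (rule Least_le) blast

lemma shortest_reflection_word:
  assumes "w \<in> carrier G"
  obtains ts where "set ts \<subseteq> T" "length ts = abs_length G S w" "list_prod G ts = w"
proof -
  have "\<exists>n ts. set ts \<subseteq> T \<and> length ts = n \<and> list_prod G ts = w"
    using word_exists[OF assms] gen_reflection by blast
  from LeastI_ex[OF this] show thesis using that unfolding abs_length_def by blast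
qed

text \<open>
  The measure that decreases when a peak is lowered: a replacement of two neighbouring letters with the
  same product changes one prefix only.
\<close>
primrec prefix_weight :: "'a \<Rightarrow> 'a list \<Rightarrow> nat" where
  "prefix_weight x [] = 0"
| "prefix_weight x (t # ts) = word_length (x \<otimes> t) + prefix_weight (x \<otimes> t) ts"

lemma prefix_weight_append:
  "x \<in> carrier G \<Longrightarrow> set ts \<subseteq> carrier G \<Longrightarrow>
    prefix_weight x (ts @ us) = prefix_weight x ts + prefix_weight (x \<otimes> list_prod G ts) us"
  by (induction ts arbitrary: x) (auto simp: m_assoc)

text \<open>
  The last letter shortens the product, so it is an inversion of an element of the subgroup and lies in it;
  removing it keeps the product in the subgroup.
\<close>
lemma increasing_word_in_parabolic:
  assumes "I \<subseteq> S" "set ts \<subseteq> T" "list_prod G ts \<in> generate G I"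
    and "\<And>a t b. ts = a @ t # b \<Longrightarrow> word_length (list_prod G a) < word_length (list_prod G a \<otimes> t)"
  shows "set ts \<subseteq> generate G I"
  using assms(2-)
proof (induction ts rule: rev_induct)
  case (snoc t ts)
  let ?P = "generate G I"
  have sub: "subgroup ?P G" using gens_subgroup assms(1) by simp
  have c: "set ts \<subseteq> carrier G" "t \<in> T" "t \<in> carrier G" using snoc.prems(1) by auto
  then have prod: "list_prod G (ts @ [t]) = list_prod G ts \<otimes> t" by simp
  have "list_prod G ts \<otimes> t \<otimes> t = list_prod G ts" using c by (simp add: m_assoc)
  then have "t \<in> inversions (list_prod G ts \<otimes> t)"
    using inversion_iff_word_length(1)[of "list_prod G ts \<otimes> t" t] snoc.prems(3)[of ts t "[]"] c by simp
  then obtain v s where "v \<in> ?P" "s \<in> I" "t = conj_by G v s"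
    using inversion_in_generate[OF assms(1)] snoc.prems(2) prod by metis
  then have tP: "t \<in> ?P" using conj_in_subgroup[OF sub] generate.incl[of s I G] by blast
  then have "list_prod G ts \<otimes> t \<otimes> t \<in> ?P"
    using snoc.prems(2) prod subgroup.m_closed[OF sub] by metis
  then have "list_prod G ts \<in> ?P" using c by (simp add: m_assoc)
  then have "set ts \<subseteq> ?P" using snoc by auto
  then show ?case using tP by simp
qed simp

lemma no_peak_increasing:
  assumes "set ts \<subseteq> T"
    and no_peak: "\<And>a t1 t2 b. ts = a @ t1 # t2 # b \<Longrightarrow>
      word_length (list_prod G a) < word_length (list_prod G a \<otimes> t1) \<Longrightarrow>
      \<not> word_length (list_prod G a \<otimes> t1 \<otimes> t2) < word_length (list_prod G a \<otimes> t1)"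
    and "ts = a @ t # b"
  shows "word_length (list_prod G a) < word_length (list_prod G a \<otimes> t)"
  using assms(3)
proof (induction a arbitrary: t b rule: rev_induct)
  case Nil
  then show ?case
    using inversion_iff_word_length(2)[of \<one> t] assms(1) by simp
next
  case (snoc t' a)
  have c: "set a \<subseteq> T" "t' \<in> T" "t \<in> T" using snoc.prems assms(1) by auto
  then have "set a \<subseteq> carrier G" by auto
  moreover have "word_length (list_prod G a) < word_length (list_prod G a \<otimes> t')"
    using snoc.IH[of t' "t # b"] snoc.prems by simp
  then have "\<not> word_length (list_prod G a \<otimes> t' \<otimes> t) < word_length (list_prod G a \<otimes> t')"
    using no_peak[of a t' t b] snoc.prems by simp
  ultimately show ?case
    using inversion_iff_word_length[of "list_prod G a \<otimes> t'" t] c by simp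
qed

text \<open>
  Minimal length is needed only to exclude \<open>t1 = t2\<close> at a peak. Lowering a peak is harmless for the
  conclusion, because the new pair of letters generates the same subgroup as the old one.
\<close>
lemma reduced_reflection_word_in_standard_parabolic:
  assumes "I \<subseteq> S" "set ts \<subseteq> T" "list_prod G ts \<in> generate G I"
    "length ts = abs_length G S (list_prod G ts)"
  shows "set ts \<subseteq> generate G I"
  using assms(2-)
proof (induction "prefix_weight \<one> ts" arbitrary: ts rule: less_induct)
  case less
  let ?P = "generate G I"
  show ?case
  proof (cases "\<exists>a t1 t2 b. ts = a @ t1 # t2 # b \<and>
      word_length (list_prod G a) < word_length (list_prod G a \<otimes> t1) \<and>
      word_length (list_prod G a \<otimes> t1 \<otimes> t2) < word_length (list_prod G a \<otimes> t1)")
    case False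
    show ?thesis
      using increasing_word_in_parabolic[OF assms(1) less.prems(1,2)]
        no_peak_increasing[OF less.prems(1)] False by blast
  next
    case True
    then obtain a t1 t2 b where ts: "ts = a @ t1 # t2 # b"
      and peak: "word_length (list_prod G a) < word_length (list_prod G a \<otimes> t1)"
        "word_length (list_prod G a \<otimes> t1 \<otimes> t2) < word_length (list_prod G a \<otimes> t1)"
      by blast
    have T: "set a \<subseteq> T" "t1 \<in> T" "t2 \<in> T" "set b \<subseteq> T" using less.prems(1) ts by auto
    then have c: "set a \<subseteq> carrier G" "t1 \<in> carrier G" "t2 \<in> carrier G" "set b \<subseteq> carrier G" by auto
    have "t1 \<noteq> t2"
    proof
      assume "t1 = t2"
      then have "list_prod G ts = list_prod G (a @ b)"
        using c T by (simp add: ts) (simp flip: m_assoc)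
      then show False
        using abs_length_le[of "a @ b"] less.prems(3) T by (simp add: ts)
    qed
    then obtain u where u: "u \<in> T" "u \<otimes> (t1 \<otimes> t2) \<in> T"
        "word_length (list_prod G a \<otimes> u) < word_length (list_prod G a \<otimes> t1)"
      and gen: "\<And>K. subgroup K G \<Longrightarrow> u \<in> K \<Longrightarrow> u \<otimes> (t1 \<otimes> t2) \<in> K \<Longrightarrow> t1 \<in> K \<and> t2 \<in> K"
      using lower_peak[OF list_prod_closed[OF c(1)] T(2,3) _ peak] by blast
    define u' where "u' = u \<otimes> (t1 \<otimes> t2)"
    define ts' where "ts' = a @ u # u' # b"
    have uu': "u \<otimes> u' = t1 \<otimes> t2" "u \<in> carrier G" "u' \<in> carrier G"
      using u c by (simp_all add: u'_def flip: m_assoc)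
    have prefix: "list_prod G a \<otimes> u \<otimes> u' = list_prod G a \<otimes> t1 \<otimes> t2"
      using uu' c by (simp add: m_assoc)
    have tail: "u \<otimes> (u' \<otimes> list_prod G b) = t1 \<otimes> (t2 \<otimes> list_prod G b)"
      using uu' c by (simp flip: m_assoc)
    have "set ts' \<subseteq> T" using T u by (simp add: ts'_def u'_def)
    moreover have prod: "list_prod G ts' = list_prod G ts"
      using c uu' by (simp add: ts'_def ts tail)
    moreover have "length ts' = length ts" by (simp add: ts'_def ts)
    moreover have "prefix_weight \<one> ts' < prefix_weight \<one> ts"
      using c uu' u(3) by (simp add: ts'_def ts prefix_weight_append prefix)
    ultimately have "set ts' \<subseteq> ?P" using less by metis
    then have P: "set a \<subseteq> ?P" "u \<in> ?P" "u \<otimes> (t1 \<otimes> t2) \<in> ?P" "set b \<subseteq> ?P"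
      by (auto simp: ts'_def u'_def)
    then have "t1 \<in> ?P \<and> t2 \<in> ?P" using gen gens_subgroup[OF assms(1)] by blast
    then show ?thesis using P by (simp add: ts)
  qed
qed

end

section \<open>Reflection length in parabolic subgroups\<close>

lemma list_prod_carrier_update [simp]: "list_prod (G\<lparr>carrier := H\<rparr>) xs = list_prod G xs"
  by (simp add: list_prod_def)

lemma (in group) subgroup_conj_by_image:
  assumes "subgroup K G" "g \<in> carrier G"
  shows "subgroup (conj_by G g ` K) G"
proof (rule subgroupI)
  have c: "x \<in> carrier G" if "x \<in> K" for x using that assms(1) subgroup.mem_carrier by metis
  show "conj_by G g ` K \<subseteq> carrier G" using c assms(2) by auto
  show "conj_by G g ` K \<noteq> {}" using subgroup.one_closed[OF assms(1)] by auto
  show "inv x \<in> conj_by G g ` K" if x: "x \<in> conj_by G g ` K" for x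
  proof -
    obtain y where "y \<in> K" "x = conj_by G g y" using x by blast
    then have "inv x = conj_by G g (inv y)" "inv y \<in> K"
      using c assms by (auto simp: conj_by_inv_right subgroup.m_inv_closed)
    then show ?thesis by blast
  qed
  show "x \<otimes> y \<in> conj_by G g ` K" if xy: "x \<in> conj_by G g ` K" "y \<in> conj_by G g ` K" for x y
  proof -
    obtain x' y' where "x' \<in> K" "x = conj_by G g x'" "y' \<in> K" "y = conj_by G g y'"
      using xy by blast
    then have "x \<otimes> y = conj_by G g (x' \<otimes> y')" "x' \<otimes> y' \<in> K"
      using c assms by (auto simp: conj_by_mult_right subgroup.m_closed)
    then show ?thesis by blast
  qed
qed

context coxeter_system
begin

abbreviation L :: "'a \<Rightarrow> nat" where "L \<equiv> abs_length G S"

lemma L_one [simp]: "L \<one> = 0"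
  using abs_length_le[of "[]"] by simp

lemma L_mult:
  assumes "x \<in> carrier G" "y \<in> carrier G" shows "L (x \<otimes> y) \<le> L x + L y"
proof -
  obtain us where us: "set us \<subseteq> T" "length us = L x" "list_prod G us = x"
    using shortest_reflection_word assms by blast
  obtain vs where vs: "set vs \<subseteq> T" "length vs = L y" "list_prod G vs = y"
    using shortest_reflection_word assms by blast
  have "set us \<subseteq> carrier G" "set vs \<subseteq> carrier G" using us vs by auto
  then show ?thesis using abs_length_le[of "us @ vs"] us vs by simp
qed

lemma L_conj [simp]:
  assumes "g \<in> carrier G" "x \<in> carrier G" shows "L (conj_by G g x) = L x"
proof -
  have le: "L (conj_by G g x) \<le> L x" if gx: "g \<in> carrier G" "x \<in> carrier G" for g x
  proof -
    obtain ts where ts: "set ts \<subseteq> T" "length ts = L x" "list_prod G ts = x"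
      using shortest_reflection_word gx by blast
    then have "set ts \<subseteq> carrier G" "set (map (conj_by G g) ts) \<subseteq> T" using gx by auto
    then show ?thesis
      using abs_length_le[of "map (conj_by G g) ts"] ts gx by (simp add: list_prod_map_conj_by)
  qed
  show ?thesis using le[of g x] le[of "inv g" "conj_by G g x"] assms by simp
qed

lemma parabolicE:
  assumes "parabolic_subgroup G S H S'"
  obtains I g where "I \<subseteq> S" "g \<in> carrier G" "H = conj_by G g ` generate G I" "S' = conj_by G g ` I"
  using assms unfolding parabolic_subgroup_def by blast

lemma parabolic_subgroup_subgroup:
  assumes "parabolic_subgroup G S H S'" shows "subgroup H G"
  using assms by (elim parabolicE) (simp add: subgroup_conj_by_image gens_subgroup)

lemma reduced_reflection_word_in_parabolic:
  assumes "parabolic_subgroup G S H S'"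
    and "set ts \<subseteq> T" "list_prod G ts \<in> H" "length ts = L (list_prod G ts)"
  shows "set ts \<subseteq> H"
proof -
  obtain I g where I: "I \<subseteq> S" "g \<in> carrier G" "H = conj_by G g ` generate G I"
    using assms(1) by (rule parabolicE)
  have c: "set ts \<subseteq> carrier G" using assms(2) by auto
  let ?us = "map (conj_by G (inv g)) ts"
  have prod: "list_prod G ?us = conj_by G (inv g) (list_prod G ts)"
    using c I by (simp add: list_prod_map_conj_by)
  obtain y where y: "y \<in> generate G I" "list_prod G ts = conj_by G g y" using assms(3) I(3) by blast
  then have "y \<in> carrier G" using gens_subgroup[OF I(1)] subgroup.mem_carrier by metis
  then have "list_prod G ?us \<in> generate G I" using y prod I by simp
  moreover have "length ?us = L (list_prod G ?us)" using assms(4) c I prod by simp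
  moreover have "set ?us \<subseteq> T" using assms(2) I by auto
  ultimately have us: "set ?us \<subseteq> generate G I"
    using reduced_reflection_word_in_standard_parabolic[OF I(1)] by blast
  show ?thesis
  proof
    fix t assume t: "t \<in> set ts"
    then have "t = conj_by G g (conj_by G (inv g) t)" using c I by auto
    moreover have "conj_by G (inv g) t \<in> generate G I" using us t by auto
    ultimately show "t \<in> H" using I(3) by blast
  qed
qed

lemma conj_by_carrier_update:
  assumes "subgroup H G" "w \<in> H"
  shows "conj_by (G\<lparr>carrier := H\<rparr>) w x = conj_by G w x"
  using assms by (simp add: conj_by_def)

text \<open>
  A reflection in the subgroup is an inversion of itself, hence a conjugate, within the subgroup, of one
  of its generators.
\<close>
lemma reflections_parabolic:
  assumes P: "parabolic_subgroup G S H S'"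
  shows "reflections (G\<lparr>carrier := H\<rparr>) S' = T \<inter> H"
proof -
  obtain I g where I: "I \<subseteq> S" "g \<in> carrier G" "H = conj_by G g ` generate G I" "S' = conj_by G g ` I"
    using P by (rule parabolicE)
  have sub: "subgroup H G" using P by (rule parabolic_subgroup_subgroup)
  have genc: "v \<in> carrier G" if "v \<in> generate G I" for v
    using that gens_subgroup[OF I(1)] subgroup.mem_carrier by metis
  have "reflections (G\<lparr>carrier := H\<rparr>) S' = {conj_by G w s | w s. w \<in> H \<and> s \<in> S'}"
    unfolding reflections_def
    by (intro Collect_cong ex_cong1) (auto simp: conj_by_carrier_update[OF sub])
  also have "\<dots> = T \<inter> H"
  proof (intro equalityI subsetI)
    fix t assume "t \<in> {conj_by G w s | w s. w \<in> H \<and> s \<in> S'}"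
    then obtain w s where ws: "w \<in> H" "s \<in> I" "t = conj_by G w (conj_by G g s)"
      using I(4) by blast
    have "s \<in> generate G I" using ws(2) by (rule generate.incl)
    then have "t \<in> H" using ws conj_in_subgroup[OF sub] I(3) by blast
    moreover have "w \<in> carrier G" using ws sub subgroup.mem_carrier by metis
    then have "t \<in> T" using ws(2,3) I(1,2) gen_reflection[of s] by (simp add: subsetD)
    ultimately show "t \<in> T \<inter> H" by simp
  next
    fix t assume t: "t \<in> T \<inter> H"
    then obtain y where y: "y \<in> generate G I" "t = conj_by G g y" using I(3) by blast
    then have "y = conj_by G (inv g) t" using I genc by simp
    then have "y \<in> T" using t I by simp
    then obtain v s where vs: "v \<in> generate G I" "s \<in> I" "y = conj_by G v s"
      using inversion_in_generate[OF I(1) y(1)] reflection_mem_inversions by blast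
    have "t = conj_by G (conj_by G g v) (conj_by G g s)"
      using y vs I genc conj_by_conj_by[of g v s] by auto
    then show "t \<in> {conj_by G w s | w s. w \<in> H \<and> s \<in> S'}" using vs I(3,4) by blast
  qed
  finally show ?thesis .
qed

lemma abs_length_parabolic:
  assumes P: "parabolic_subgroup G S H S'" and "x \<in> H"
  shows "abs_length (G\<lparr>carrier := H\<rparr>) S' x = L x"
proof -
  have sub: "subgroup H G" using P by (rule parabolic_subgroup_subgroup)
  then have "x \<in> carrier G" using assms(2) subgroup.mem_carrier by metis
  then obtain ts where ts: "set ts \<subseteq> T" "length ts = L x" "list_prod G ts = x"
    using shortest_reflection_word by blast
  then have tsH: "set ts \<subseteq> H" using reduced_reflection_word_in_parabolic[OF P] assms(2) by auto
  show ?thesis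
    unfolding abs_length_def[of "G\<lparr>carrier := H\<rparr>"] reflections_parabolic[OF P]
  proof (rule Least_equality)
    show "\<exists>ts. set ts \<subseteq> T \<inter> H \<and> length ts = L x \<and> list_prod (G\<lparr>carrier := H\<rparr>) ts = x"
      using ts tsH by auto
    show "L x \<le> n" if "\<exists>ts. set ts \<subseteq> T \<inter> H \<and> length ts = n \<and> list_prod (G\<lparr>carrier := H\<rparr>) ts = x" for n
      using that abs_length_le by auto
  qed
qed

text \<open>
  If \<open>x \<le> y\<close>, shortest words for \<open>x\<close> and for \<open>x\<^sup>-\<^sup>1 y\<close> join to a shortest word for \<open>y\<close>, whose letters
  all lie in \<open>H\<close>.
\<close>
lemma below_parabolic_element:
  assumes P: "parabolic_subgroup G S H S'" and y: "y \<in> H" and x: "x \<in> carrier G" "abs_le G S x y"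
  shows "x \<in> H"
proof -
  have sub: "subgroup H G" using P by (rule parabolic_subgroup_subgroup)
  have yc: "y \<in> carrier G" using y sub subgroup.mem_carrier by metis
  obtain us where us: "set us \<subseteq> T" "length us = L x" "list_prod G us = x"
    using shortest_reflection_word x by blast
  obtain vs where vs: "set vs \<subseteq> T" "length vs = L (inv x \<otimes> y)" "list_prod G vs = inv x \<otimes> y"
    using shortest_reflection_word[of "inv x \<otimes> y"] x(1) yc m_closed inv_closed by metis
  have c: "set us \<subseteq> carrier G" "set vs \<subseteq> carrier G" using us vs by auto
  then have prod: "list_prod G (us @ vs) = y" using us vs x(1) yc by simp
  have "length (us @ vs) = L (list_prod G (us @ vs))"
    unfolding prod using us vs x(2) by (simp add: abs_le_def)
  then have "set (us @ vs) \<subseteq> H"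
    using us vs y prod by (intro reduced_reflection_word_in_parabolic[OF P]) auto
  then show ?thesis using list_prod_in_subgroup[OF sub, of us] us by simp
qed

lemma abs_le_parabolic:
  assumes P: "parabolic_subgroup G S H S'" and "x \<in> H" "y \<in> H"
  shows "abs_le (G\<lparr>carrier := H\<rparr>) S' x y = abs_le G S x y"
proof -
  have sub: "subgroup H G" using P by (rule parabolic_subgroup_subgroup)
  then have "inv x \<otimes> y \<in> H" using assms by (simp add: subgroup.m_closed subgroup.m_inv_closed)
  then show ?thesis
    using assms sub by (simp add: abs_le_def abs_length_parabolic)
qed

lemma NC_parabolic:
  assumes P: "parabolic_subgroup G S H S'" and "y \<in> H"
  shows "NC (G\<lparr>carrier := H\<rparr>) S' y = NC G S y" and "NC G S y \<subseteq> H"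
proof -
  have sub: "subgroup H G" using P by (rule parabolic_subgroup_subgroup)
  show "NC G S y \<subseteq> H"
    using below_parabolic_element[OF assms] by (auto simp: NC_def)
  moreover have "abs_le (G\<lparr>carrier := H\<rparr>) S' \<one> w = abs_le G S \<one> w" if "w \<in> H" for w
    using abs_le_parabolic[OF P subgroup.one_closed[OF sub]] that by simp
  ultimately show "NC (G\<lparr>carrier := H\<rparr>) S' y = NC G S y"
    using abs_le_parabolic[OF P] assms(2) subgroup.mem_carrier[OF sub]
    by (auto simp: NC_def)
qed

lemma multichains_parabolic:
  assumes P: "parabolic_subgroup G S H S'" and y: "y \<in> H"
  shows "multichains (G\<lparr>carrier := H\<rparr>) S' y k = multichains G S y k"
proof -
  have "abs_le (G\<lparr>carrier := H\<rparr>) S' (p i) (p (Suc i)) = abs_le G S (p i) (p (Suc i))"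
    if "p \<in> {1..k} \<rightarrow>\<^sub>E NC G S y" "i \<in> {1..<k}" for p i
  proof -
    have "p i \<in> NC G S y" "p (Suc i) \<in> NC G S y"
      using PiE_mem[OF that(1), of i] PiE_mem[OF that(1), of "Suc i"] that(2) by auto
    then show ?thesis using NC_parabolic(2)[OF assms] abs_le_parabolic[OF P] by blast
  qed
  then show ?thesis unfolding multichains_def NC_parabolic(1)[OF assms] by auto
qed

lemma delta_sequences_parabolic:
  assumes P: "parabolic_subgroup G S H S'" and y: "y \<in> H"
  shows "delta_sequences (G\<lparr>carrier := H\<rparr>) S' y k = delta_sequences G S y k"
proof -
  have sub: "subgroup H G" using P by (rule parabolic_subgroup_subgroup)
  have mem: "d i \<in> H" if "d \<in> {1..k} \<rightarrow>\<^sub>E NC G S y" "i \<in> {1..k}" for d i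
    using PiE_mem[OF that] NC_parabolic(2)[OF assms] by blast
  have prod: "list_prod G (map d [1..<Suc k]) \<in> H" if "d \<in> {1..k} \<rightarrow>\<^sub>E NC G S y" for d
    using mem[OF that] by (intro list_prod_in_subgroup[OF sub]) auto
  have sum: "(\<Sum>i=1..k. abs_length (G\<lparr>carrier := H\<rparr>) S' (d i)) = (\<Sum>i=1..k. L (d i))"
    if "d \<in> {1..k} \<rightarrow>\<^sub>E NC G S y" for d
    using mem[OF that] abs_length_parabolic[OF P] by (intro sum.cong) auto
  have d0: "abs_length (G\<lparr>carrier := H\<rparr>) S'
      (y \<otimes>\<^bsub>G\<lparr>carrier := H\<rparr>\<^esub> inv\<^bsub>G\<lparr>carrier := H\<rparr>\<^esub> (list_prod (G\<lparr>carrier := H\<rparr>) (map d [1..<Suc k])))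
      = L (y \<otimes> inv (list_prod G (map d [1..<Suc k])))" if "d \<in> {1..k} \<rightarrow>\<^sub>E NC G S y" for d
  proof -
    have "y \<otimes> inv (list_prod G (map d [1..<Suc k])) \<in> H"
      using y prod[OF that] sub by (intro subgroup.m_closed subgroup.m_inv_closed)
    then show ?thesis
      using prod[OF that] by (simp add: m_inv_consistent[OF sub] abs_length_parabolic[OF P] del: upt_Suc)
  qed
  have "d \<in> delta_sequences (G\<lparr>carrier := H\<rparr>) S' y k \<longleftrightarrow> d \<in> delta_sequences G S y k" for d
  proof (cases "d \<in> {1..k} \<rightarrow>\<^sub>E NC G S y")
    case True
    then show ?thesis
      unfolding delta_sequences_def NC_parabolic(1)[OF assms] Let_def mem_Collect_eq
        sum[OF True] d0[OF True] abs_length_parabolic[OF assms] by simp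
  next
    case False
    then show ?thesis by (simp add: delta_sequences_def NC_parabolic(1)[OF assms])
  qed
  then show ?thesis by blast
qed

lemma componentwise_le_parabolic:
  assumes P: "parabolic_subgroup G S H S'" and "\<And>i. i \<in> {1..k} \<Longrightarrow> d i \<in> H \<and> e i \<in> H"
  shows "componentwise_le (G\<lparr>carrier := H\<rparr>) S' k d e = componentwise_le G S k d e"
  using assms(2) abs_le_parabolic[OF P] by (simp add: componentwise_le_def)

lemma multichain_le_parabolic:
  assumes P: "parabolic_subgroup G S H S'" and y: "y \<in> H"
    and pq: "\<And>i. i \<in> {1..k} \<Longrightarrow> p i \<in> H \<and> q i \<in> H"
  shows "multichain_le (G\<lparr>carrier := H\<rparr>) S' y k p q = multichain_le G S y k p q"
proof -
  have sub: "subgroup H G" using P by (rule parabolic_subgroup_subgroup)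
  have delta: "delta (G\<lparr>carrier := H\<rparr>) y k r = delta G y k r"
    and mem: "i \<in> {1..k} \<Longrightarrow> delta G y k r i \<in> H" if "\<And>i. i \<in> {1..k} \<Longrightarrow> r i \<in> H" for r i
    using that y sub
    by (auto simp: delta_def subgroup.m_closed subgroup.m_inv_closed intro!: restrict_ext)
  show ?thesis
    unfolding multichain_le_def
    using delta[of p] delta[of q] mem[of p] mem[of q] pq componentwise_le_parabolic[OF P] by simp
qed

end

section \<open>Delta sequences\<close>

context coxeter_system
begin

abbreviation seg :: "(nat \<Rightarrow> 'a) \<Rightarrow> nat \<Rightarrow> nat \<Rightarrow> 'a" where
  "seg d m n \<equiv> list_prod G (map d [m..<n])"

lemma seg_closed: "(\<And>i. i \<in> {m..<n} \<Longrightarrow> d i \<in> carrier G) \<Longrightarrow> seg d m n \<in> carrier G"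
  by (intro list_prod_closed) auto

lemma seg_append:
  assumes "\<And>i. i \<in> {l..<n} \<Longrightarrow> d i \<in> carrier G" "l \<le> m" "m \<le> n"
  shows "seg d l n = seg d l m \<otimes> seg d m n"
proof -
  have "[l..<n] = [l..<m] @ [m..<n]"
    using assms by (metis le_add_diff_inverse upt_add_eq_append)
  moreover have "set (map d [l..<m]) \<subseteq> carrier G" "set (map d [m..<n]) \<subseteq> carrier G"
    using assms by auto
  ultimately show ?thesis by simp
qed

lemma seg_Suc:
  assumes "\<And>i. i \<in> {m..n} \<Longrightarrow> d i \<in> carrier G" "m \<le> n"
  shows "seg d m (Suc n) = seg d m n \<otimes> d n"
proof -
  have "seg d n (Suc n) = d n" using assms by simp
  then show ?thesis using seg_append[of m "Suc n" d n] assms by simp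
qed

lemma L_seg_le:
  assumes "\<And>i. i \<in> {m..<n} \<Longrightarrow> d i \<in> carrier G"
  shows "L (seg d m n) \<le> (\<Sum>i=m..<n. L (d i))"
  using assms
proof (induction n)
  case (Suc n)
  show ?case
  proof (cases "m \<le> n")
    case True
    have "L (seg d m (Suc n)) \<le> L (seg d m n) + L (d n)"
      using seg_Suc[of m n d] L_mult[of "seg d m n" "d n"] seg_closed[of m n d] Suc.prems True
      by (simp del: upt_Suc)
    then show ?thesis using Suc True by fastforce
  qed simp
qed simp

text \<open>
  Subadditivity holds for the three parts of the product before \<open>i\<close>, from \<open>i\<close> to \<open>j\<close>, and after \<open>j\<close>; when the
  total is additive, each of these inequalities must be an equality.
\<close>
lemma additive_segments:
  assumes d: "\<And>i. i \<in> {1..k} \<Longrightarrow> d i \<in> carrier G" and x: "x \<in> carrier G"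
    and add: "L (x \<otimes> seg d 1 (Suc k)) = L x + (\<Sum>i=1..k. L (d i))"
    and ij: "1 \<le> i" "i \<le> j" "j \<le> Suc k"
  shows "L (x \<otimes> seg d 1 i) = L x + (\<Sum>l=1..<i. L (d l))"
    and "L (seg d i j) = (\<Sum>l=i..<j. L (d l))"
proof -
  have c: "d l \<in> carrier G" if "l \<in> {1..<Suc k}" for l using d that by auto
  have segc: "seg d a b \<in> carrier G" if "1 \<le> a" "b \<le> Suc k" for a b
    using that c by (intro seg_closed) auto
  have le: "L (seg d a b) \<le> (\<Sum>l=a..<b. L (d l))" if "1 \<le> a" "b \<le> Suc k" for a b
    using that c by (intro L_seg_le) auto
  have le1: "L (x \<otimes> seg d 1 i) \<le> L x + (\<Sum>l=1..<i. L (d l))"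
    using L_mult[OF x segc[of 1 i]] le[of 1 i] ij by linarith
  have "seg d 1 (Suc k) = seg d 1 i \<otimes> (seg d i j \<otimes> seg d j (Suc k))"
    using seg_append[of 1 "Suc k" d i] seg_append[of i "Suc k" d j] c ij by (simp del: upt_Suc)
  then have eq: "x \<otimes> seg d 1 (Suc k) = (x \<otimes> seg d 1 i) \<otimes> (seg d i j \<otimes> seg d j (Suc k))"
    using x segc ij by (simp add: m_assoc del: upt_Suc)
  have "L (x \<otimes> seg d 1 (Suc k)) \<le> L (x \<otimes> seg d 1 i) + (L (seg d i j) + L (seg d j (Suc k)))"
    unfolding eq using x segc ij
    by (intro order.trans[OF L_mult] add_left_mono L_mult m_closed) (auto simp del: upt_Suc)
  moreover have "(\<Sum>l=1..k. L (d l)) =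
      (\<Sum>l=1..<i. L (d l)) + ((\<Sum>l=i..<j. L (d l)) + (\<Sum>l=j..<Suc k. L (d l)))"
  proof -
    have "(\<Sum>l=1..<Suc k. L (d l)) = (\<Sum>l=1..<i. L (d l)) + (\<Sum>l=i..<Suc k. L (d l))"
      using ij by (intro sum.atLeastLessThan_concat[symmetric]) auto
    moreover have "(\<Sum>l=i..<Suc k. L (d l)) = (\<Sum>l=i..<j. L (d l)) + (\<Sum>l=j..<Suc k. L (d l))"
      using ij by (intro sum.atLeastLessThan_concat[symmetric]) auto
    ultimately show ?thesis by (simp only: atLeastLessThanSuc_atLeastAtMost)
  qed
  ultimately show "L (x \<otimes> seg d 1 i) = L x + (\<Sum>l=1..<i. L (d l))"
    and "L (seg d i j) = (\<Sum>l=i..<j. L (d l))"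
    using add le1 le[of i j] le[of j "Suc k"] ij by linarith+
qed

text \<open>
  A middle factor can be moved to the front at the cost of conjugating the factor that it passes, which
  does not change lengths.
\<close>
lemma additive_factor_le:
  assumes "a \<in> carrier G" "b \<in> carrier G" "d \<in> carrier G"
    and "L (a \<otimes> b \<otimes> d) = L a + L b + L d"
  shows "abs_le G S b (a \<otimes> b \<otimes> d)"
proof -
  let ?q = "inv b \<otimes> (a \<otimes> b \<otimes> d)"
  have "?q = conj_by G (inv b) a \<otimes> d" using assms by (simp add: conj_by_def m_assoc)
  then have "L ?q \<le> L a + L d"
    using L_mult[of "conj_by G (inv b) a" d] assms by simp
  moreover have "L (b \<otimes> ?q) \<le> L b + L ?q" using assms by (intro L_mult) simp_all
  moreover have "b \<otimes> ?q = a \<otimes> b \<otimes> d" using assms by simp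
  ultimately show ?thesis using assms(4) by (simp add: abs_le_def)
qed

lemma NC_iff: "w \<in> NC G S c \<longleftrightarrow> w \<in> carrier G \<and> abs_le G S w c"
  by (auto simp: NC_def abs_le_def)

text \<open>
  The additive length condition alone forces the entries to lie below \<open>c\<close>, because each of them is a
  factor of an additive product.
\<close>
lemma delta_sequence_iff:
  assumes c: "c \<in> carrier G" and d: "d \<in> {1..k} \<rightarrow>\<^sub>E carrier G"
  shows "d \<in> delta_sequences G S c k \<longleftrightarrow>
    L c = L (c \<otimes> inv (seg d 1 (Suc k))) + (\<Sum>i=1..k. L (d i))"
proof
  assume add: "L c = L (c \<otimes> inv (seg d 1 (Suc k))) + (\<Sum>i=1..k. L (d i))"
  let ?x = "c \<otimes> inv (seg d 1 (Suc k))"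
  have dc: "d i \<in> carrier G" if "i \<in> {1..k}" for i using PiE_mem[OF d that] .
  have segc: "seg d a b \<in> carrier G" if "1 \<le> a" "b \<le> Suc k" for a b
    using that dc by (intro seg_closed) auto
  have x: "?x \<in> carrier G" "?x \<otimes> seg d 1 (Suc k) = c"
    using c segc[of 1 "Suc k"] by (simp_all add: m_assoc del: upt_Suc)
  have "d i \<in> NC G S c" if i: "i \<in> {1..k}" for i
  proof -
    have split: "seg d 1 (Suc k) = seg d 1 i \<otimes> d i \<otimes> seg d (Suc i) (Suc k)"
      using seg_append[of 1 "Suc k" d "Suc i"] seg_Suc[of 1 i d] dc i by (simp del: upt_Suc)
    have ceq: "c = ?x \<otimes> seg d 1 i \<otimes> d i \<otimes> seg d (Suc i) (Suc k)"
    proof -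
      have "c = ?x \<otimes> (seg d 1 i \<otimes> d i \<otimes> seg d (Suc i) (Suc k))" using x(2) split by simp
      then show ?thesis using x(1) segc[of 1 i] segc[of "Suc i" "Suc k"] dc[OF i] i
        by (simp add: m_assoc del: upt_Suc)
    qed
    have add': "L (?x \<otimes> seg d 1 (Suc k)) = L ?x + (\<Sum>i=1..k. L (d i))" using x(2) add by simp
    have "L (?x \<otimes> seg d 1 i) = L ?x + (\<Sum>l=1..<i. L (d l))"
      using additive_segments(1)[OF dc x(1) add', of i i] i by simp
    moreover have "L (seg d (Suc i) (Suc k)) = (\<Sum>l=Suc i..<Suc k. L (d l))"
      using additive_segments(2)[OF dc x(1) add', of "Suc i" "Suc k"] i by simp
    moreover have "(\<Sum>l=1..k. L (d l)) =
        (\<Sum>l=1..<i. L (d l)) + L (d i) + (\<Sum>l=Suc i..<Suc k. L (d l))"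
    proof -
      have "(\<Sum>l=1..<Suc i. L (d l)) + (\<Sum>l=Suc i..<Suc k. L (d l)) = (\<Sum>l=1..<Suc k. L (d l))"
        using i by (intro sum.atLeastLessThan_concat) auto
      moreover have "(\<Sum>l=1..<Suc i. L (d l)) = (\<Sum>l=1..<i. L (d l)) + L (d i)"
        using i by (intro sum.atLeastLessThan_Suc) auto
      ultimately show ?thesis by (simp only: atLeastLessThanSuc_atLeastAtMost)
    qed
    ultimately have "L c = L (?x \<otimes> seg d 1 i) + L (d i) + L (seg d (Suc i) (Suc k))"
      using add by linarith
    then have "L (?x \<otimes> seg d 1 i \<otimes> d i \<otimes> seg d (Suc i) (Suc k)) =
        L (?x \<otimes> seg d 1 i) + L (d i) + L (seg d (Suc i) (Suc k))"
      unfolding ceq[symmetric] .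
    then have "abs_le G S (d i) (?x \<otimes> seg d 1 i \<otimes> d i \<otimes> seg d (Suc i) (Suc k))"
      using x(1) segc[of 1 i] segc[of "Suc i" "Suc k"] dc[OF i] i
      by (intro additive_factor_le m_closed[of ?x]) auto
    then show ?thesis using dc[OF i] unfolding NC_iff ceq[symmetric] by simp
  qed
  then have "d \<in> {1..k} \<rightarrow>\<^sub>E NC G S c" using d by (auto simp: PiE_iff)
  then show "d \<in> delta_sequences G S c k" using add by (simp add: delta_sequences_def)
qed (simp add: delta_sequences_def)

lemma seg_quotients:
  assumes "\<And>i. i \<in> {m..n} \<Longrightarrow> f i \<in> carrier G" "m \<le> n"
  shows "seg (\<lambda>i. inv (f i) \<otimes> f (Suc i)) m n = inv (f m) \<otimes> f n"
  using assms(2,1)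
proof (induction n rule: dec_induct)
  case (step n)
  then have "f m \<in> carrier G" "f n \<in> carrier G" "f (Suc n) \<in> carrier G" by auto
  then show ?case
    using step seg_Suc[of m n "\<lambda>i. inv (f i) \<otimes> f (Suc i)"] by (simp add: m_assoc del: upt_Suc)
qed simp

text \<open>
  In one direction the lengths along the chain telescope. In the other, \<open>\<delta>\<^sub>0\<close> equals \<open>q\<^sub>1\<close> and the initial
  segments of the additive product \<open>\<delta>\<^sub>0 \<delta>\<^sub>1 \<dots> \<delta>\<^sub>k = c\<close> are the \<open>q\<^sub>i\<close>.
\<close>
lemma multichain_iff_delta_sequence:
  assumes c: "c \<in> carrier G" and q: "q \<in> {1..k} \<rightarrow>\<^sub>E carrier G" and k: "k \<ge> 1"
  shows "q \<in> multichains G S c k \<longleftrightarrow> delta G c k q \<in> delta_sequences G S c k"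
proof -
  define Q where "Q = q(Suc k := c)"
  define e where "e = delta G c k q"
  have Qq: "Q i = q i" if "i \<in> {1..k}" for i using that by (simp add: Q_def)
  have Qk: "Q (Suc k) = c" by (simp add: Q_def)
  have Qc: "Q i \<in> carrier G" if "i \<in> {1..Suc k}" for i
    using that PiE_mem[OF q, of i] c by (auto simp: Q_def)
  have e: "e i = inv (Q i) \<otimes> Q (Suc i)" if "i \<in> {1..k}" for i
    using that by (simp add: e_def delta_def Q_def)
  have ec: "e \<in> {1..k} \<rightarrow>\<^sub>E carrier G"
    using e Qc by (auto simp: PiE_iff) (simp add: e_def delta_def)
  have seg: "seg e m n = inv (Q m) \<otimes> Q n" if "1 \<le> m" "m \<le> n" "n \<le> Suc k" for m n
  proof -
    have "seg e m n = seg (\<lambda>i. inv (Q i) \<otimes> Q (Suc i)) m n"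
      using e that by (intro arg_cong[where f = "list_prod G"] map_cong) auto
    also have "\<dots> = inv (Q m) \<otimes> Q n" by (rule seg_quotients) (use Qc that in auto)
    finally show ?thesis .
  qed
  have d0: "c \<otimes> inv (seg e 1 (Suc k)) = Q 1"
    using seg[of 1 "Suc k"] Qc[of 1] c k Qk by (simp add: inv_mult_group del: upt_Suc)
  have iff: "e \<in> delta_sequences G S c k \<longleftrightarrow> L c = L (Q 1) + (\<Sum>i=1..k. L (e i))"
    using delta_sequence_iff[OF c ec] d0 by simp
  have "q \<in> multichains G S c k \<longleftrightarrow> e \<in> delta_sequences G S c k"
  proof
    assume q': "q \<in> multichains G S c k"
    have step: "L (Q (Suc i)) = L (Q i) + L (e i)" if i: "i \<in> {1..k}" for i
    proof (cases "i = k")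
      case True
      have "q k \<in> NC G S c" using q' k by (auto simp: multichains_def)
      then show ?thesis using True e[of k] Qq[of k] Qk k by (simp add: NC_iff abs_le_def)
    next
      case False
      then have "abs_le G S (q i) (q (Suc i))" using q' i by (simp add: multichains_def)
      then show ?thesis using False i e[of i] Qq[of i] Qq[of "Suc i"] by (simp add: abs_le_def)
    qed
    have "L (Q (Suc n)) = L (Q 1) + (\<Sum>i=1..n. L (e i))" if "n \<le> k" for n
      using that step by (induction n) auto
    from this[of k] show "e \<in> delta_sequences G S c k" using iff Qk by simp
  next
    assume "e \<in> delta_sequences G S c k"
    then have add: "L (Q 1 \<otimes> seg e 1 (Suc k)) = L (Q 1) + (\<Sum>i=1..k. L (e i))"
      using iff seg[of 1 "Suc k"] Qc[of 1] c Qk k by (simp del: upt_Suc)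
    have ec': "e i \<in> carrier G" if "i \<in> {1..k}" for i using PiE_mem[OF ec that] .
    note segments = additive_segments[OF ec' Qc add]
    have LQ: "L (Q i) = L (Q 1) + (\<Sum>l=1..<i. L (e l))" if "i \<in> {1..Suc k}" for i
      using segments(1)[of i i] seg[of 1 i] Qc[of 1] Qc[of i] that by simp
    have Lseg: "L (inv (Q i) \<otimes> Q j) = (\<Sum>l=i..<j. L (e l))" if "1 \<le> i" "i \<le> j" "j \<le> Suc k" for i j
      using segments(2)[of i j] seg[of i j] that by simp
    have le: "abs_le G S (Q i) (Q j)" if "1 \<le> i" "i \<le> j" "j \<le> Suc k" for i j
    proof -
      have "(\<Sum>l=1..<i. L (e l)) + (\<Sum>l=i..<j. L (e l)) = (\<Sum>l=1..<j. L (e l))"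
        using that by (intro sum.atLeastLessThan_concat) auto
      then show ?thesis using LQ[of i] LQ[of j] Lseg[of i j] that by (simp add: abs_le_def)
    qed
    have "q i \<in> NC G S c" if "i \<in> {1..k}" for i
      using le[of i "Suc k"] that Qq[OF that] Qk Qc[of i] by (simp add: NC_iff)
    moreover have "abs_le G S (q i) (q (Suc i))" if "i \<in> {1..<k}" for i
      using le[of i "Suc i"] that Qq[of i] Qq[of "Suc i"] by simp
    ultimately show "q \<in> multichains G S c k"
      using q by (auto simp: multichains_def PiE_iff)
  qed
  then show ?thesis by (simp add: e_def)
qed

end

section \<open>The two isomorphisms\<close>

lemma (in group) bij_betw_translate_tuples:
  assumes "\<And>i. i \<in> I \<Longrightarrow> l i \<in> carrier G \<and> r i \<in> carrier G"
  shows "bij_betw (\<lambda>e. \<lambda>i\<in>I. l i \<otimes> e i \<otimes> r i) (I \<rightarrow>\<^sub>E carrier G) (I \<rightarrow>\<^sub>E carrier G)"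
proof (rule bij_betw_byWitness[where f' = "\<lambda>e. \<lambda>i\<in>I. inv (l i) \<otimes> e i \<otimes> inv (r i)"])
  show "\<forall>e\<in>I \<rightarrow>\<^sub>E carrier G. (\<lambda>i\<in>I. inv (l i) \<otimes> (\<lambda>i\<in>I. l i \<otimes> e i \<otimes> r i) i \<otimes> inv (r i)) = e"
  proof
    fix e assume e: "e \<in> I \<rightarrow>\<^sub>E carrier G"
    show "(\<lambda>i\<in>I. inv (l i) \<otimes> (\<lambda>i\<in>I. l i \<otimes> e i \<otimes> r i) i \<otimes> inv (r i)) = e"
      using PiE_mem[OF e] PiE_arb[OF e] assms by (auto simp: fun_eq_iff restrict_def m_assoc)
  qed
  show "\<forall>e\<in>I \<rightarrow>\<^sub>E carrier G. (\<lambda>i\<in>I. l i \<otimes> (\<lambda>i\<in>I. inv (l i) \<otimes> e i \<otimes> inv (r i)) i \<otimes> r i) = e"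
  proof
    fix e assume e: "e \<in> I \<rightarrow>\<^sub>E carrier G"
    show "(\<lambda>i\<in>I. l i \<otimes> (\<lambda>i\<in>I. inv (l i) \<otimes> e i \<otimes> inv (r i)) i \<otimes> r i) = e"
      using PiE_mem[OF e] PiE_arb[OF e] assms by (auto simp: fun_eq_iff restrict_def m_assoc)
  qed
qed (use assms in \<open>auto dest: PiE_mem\<close>)

lemma bij_betw_restrict_iff:
  assumes "bij_betw f A B" "\<And>x. x \<in> A \<Longrightarrow> x \<in> C \<longleftrightarrow> f x \<in> D" "C \<subseteq> A" "D \<subseteq> B"
  shows "bij_betw f C D"
proof -
  have "f ` C = D"
  proof (intro equalityI subsetI)
    fix y assume "y \<in> D"
    then obtain x where "x \<in> A" "y = f x" using assms(1,4) by (auto simp: bij_betw_def)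
    then show "y \<in> f ` C" using assms(2) \<open>y \<in> D\<close> by auto
  qed (use assms(2,3) in auto)
  then show ?thesis using assms(1,3) by (auto simp: bij_betw_def intro: inj_on_subset)
qed

context coxeter_system
begin

lemma tuples_in_carrier:
  "delta_sequences G S c k \<subseteq> {1..k} \<rightarrow>\<^sub>E carrier G"
  "multichains G S c k \<subseteq> {1..k} \<rightarrow>\<^sub>E carrier G"
proof -
  have "{1..k} \<rightarrow>\<^sub>E NC G S c \<subseteq> {1..k} \<rightarrow>\<^sub>E carrier G" by (rule PiE_mono) (auto simp: NC_def)
  then show "delta_sequences G S c k \<subseteq> {1..k} \<rightarrow>\<^sub>E carrier G"
    "multichains G S c k \<subseteq> {1..k} \<rightarrow>\<^sub>E carrier G"
    unfolding delta_sequences_def multichains_def by blast+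
qed

text \<open>
  Both maps translate every entry by fixed group elements, so they are bijections on the tuples with
  entries in the group, and it remains to see which tuples they send to multichains or delta
  sequences below \<open>\<pi>\<^sub>1\<close>. For part (2) this is \<open>mem_iff\<close> in the proof, and \<open>delta_f\<close> carries it over to part (1).
\<close>
lemma multichain_posets_iso:
  assumes c: "c \<in> carrier G" and k: "k \<ge> 1" and p: "p \<in> multichains G S c k"
  defines "P \<equiv> p(Suc k := c)"
  defines "f \<equiv> \<lambda>q. \<lambda>i\<in>{1..k}. if i = 1 then q 1 else q i \<otimes> inv (p i) \<otimes> p 1"
    and "g \<equiv> \<lambda>e. \<lambda>i\<in>{1..k}. inv (p 1) \<otimes> p i \<otimes> e i \<otimes> inv (P (Suc i)) \<otimes> p 1"
  shows "poset_iso f {q \<in> multichains G S c k. multichain_le G S c k q p} (multichain_le G S c k)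
      (multichains G S (p 1) k) (multichain_le G S (p 1) k)" (is ?ideal)
    and "poset_iso g {e \<in> delta_sequences G S c k. componentwise_le G S k (delta G c k p) e}
      (componentwise_le G S k) (delta_sequences G S (p 1) k) (componentwise_le G S k)" (is ?filter)
proof -
  let ?X = "{1..k} \<rightarrow>\<^sub>E carrier G"
  have pX: "p \<in> ?X" using p tuples_in_carrier(2) by blast
  have pc: "p i \<in> carrier G" if "i \<in> {1..k}" for i using PiE_mem[OF pX that] .
  have p1: "p 1 \<in> carrier G" using pc k by simp
  have Pc: "P i \<in> carrier G" if "i \<in> {1..Suc k}" for i using that pc c by (auto simp: P_def)
  have Pp: "P i = p i" if "i \<in> {1..k}" for i using that by (simp add: P_def)
  have Pk: "P (Suc k) = c" by (simp add: P_def)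
  \<comment> \<open>In terms of \<open>a\<close> the map \<open>g\<close> sends \<open>e i\<close> to \<open>a i (e i) (a (i + 1))\<^sup>-\<^sup>1\<close>, so products telescope.\<close>
  define a where "a i = inv (p 1) \<otimes> P i" for i
  have ac: "a i \<in> carrier G" if "i \<in> {1..Suc k}" for i using Pc that p1 by (simp add: a_def)
  have a1: "a 1 = \<one>" using Pp[of 1] p1 k by (simp add: a_def)
  define d where "d = delta G c k p"
  have d: "d i = inv (a i) \<otimes> a (Suc i)" "d i \<in> carrier G" if "i \<in> {1..k}" for i
  proof -
    have "P i \<in> carrier G" "P (Suc i) \<in> carrier G" using Pc that by auto
    then show "d i = inv (a i) \<otimes> a (Suc i)" "d i \<in> carrier G"
      using that p1 Pp[OF that]
      by (simp_all add: d_def delta_def a_def inv_mult_group m_assoc flip: P_def)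
  qed
  have g: "g e i = a i \<otimes> e i \<otimes> inv (a (Suc i))" if "i \<in> {1..k}" "e i \<in> carrier G" for e i
    using that pc[of i] p1 Pc[of "Suc i"] Pp[of i] by (simp add: g_def a_def inv_mult_group m_assoc)
  have gX: "bij_betw g ?X ?X"
  proof -
    have "bij_betw (\<lambda>e. \<lambda>i\<in>{1..k}. a i \<otimes> e i \<otimes> inv (a (Suc i))) ?X ?X"
      by (rule bij_betw_translate_tuples) (use ac in auto)
    moreover have "g e = (\<lambda>i\<in>{1..k}. a i \<otimes> e i \<otimes> inv (a (Suc i)))" if "e \<in> ?X" for e
      using g[of _ e] PiE_mem[OF that] by (auto simp: g_def fun_eq_iff restrict_def)
    ultimately show ?thesis using bij_betw_cong[of ?X g] by simp
  qed
  have gmem: "g e \<in> ?X" if "e \<in> ?X" for e using bij_betwE[OF gX] that by blast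
  have g_conj: "g e i = conj_by G (a i) (e i \<otimes> inv (d i))" if "i \<in> {1..k}" "e i \<in> carrier G" for e i
    using that ac[of i] ac[of "Suc i"] by (simp add: g d conj_by_def inv_mult_group m_assoc)
  have Lg: "L (g e i) = L (inv (d i) \<otimes> e i)" if "i \<in> {1..k}" "e i \<in> carrier G" for e i
  proof -
    have "conj_by G (inv (d i)) (e i \<otimes> inv (d i)) = inv (d i) \<otimes> e i"
      using that d(2)[of i] by (simp add: conj_by_def m_assoc)
    moreover have "L (conj_by G (inv (d i)) (e i \<otimes> inv (d i))) = L (e i \<otimes> inv (d i))"
      using that d(2)[of i] by simp
    ultimately show ?thesis using that d(2)[of i] ac[of i] by (simp add: g_conj)
  qed
  have Lg_le: "L (e i) \<le> L (d i) + L (g e i)" if "i \<in> {1..k}" "e i \<in> carrier G" for e i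
    using L_mult[of "d i" "inv (d i) \<otimes> e i"] that d(2)[of i] Lg by simp
  have seg_g: "seg (g e) 1 (Suc n) = seg e 1 (Suc n) \<otimes> inv (a (Suc n))" if e: "e \<in> ?X" and "n \<le> k" for e n
    using that(2)
  proof (induction n)
    case 0
    then show ?case using a1 by simp
  next
    case (Suc n)
    have ge: "g e i \<in> carrier G" "e i \<in> carrier G" if "i \<in> {1..k}" for i
      using PiE_mem[OF gmem[OF e] that] PiE_mem[OF e that] by simp_all
    have s: "seg e 1 (Suc n) \<in> carrier G" using ge Suc by (intro seg_closed) auto
    have "seg (g e) 1 (Suc (Suc n)) = seg (g e) 1 (Suc n) \<otimes> g e (Suc n)"
      using ge Suc.prems by (intro seg_Suc) auto
    also have "\<dots> = seg e 1 (Suc n) \<otimes> inv (a (Suc n)) \<otimes>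
        (a (Suc n) \<otimes> e (Suc n) \<otimes> inv (a (Suc (Suc n))))"
      using Suc ge by (simp add: g del: upt_Suc)
    also have "\<dots> = seg e 1 (Suc n) \<otimes> e (Suc n) \<otimes> inv (a (Suc (Suc n)))"
      using s ge[of "Suc n"] ac[of "Suc n"] ac[of "Suc (Suc n)"] Suc.prems
      by (simp add: m_assoc del: upt_Suc)
    also have "seg e 1 (Suc n) \<otimes> e (Suc n) = seg e 1 (Suc (Suc n))"
      using ge Suc.prems by (intro seg_Suc[symmetric]) auto
    finally show ?case .
  qed
  \<comment> \<open>The entries of index \<open>0\<close> of \<open>e\<close> and of \<open>g e\<close> coincide.\<close>
  have first: "p 1 \<otimes> inv (seg (g e) 1 (Suc k)) = c \<otimes> inv (seg e 1 (Suc k))" if e: "e \<in> ?X" for e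
  proof -
    have s: "seg e 1 (Suc k) \<in> carrier G" using PiE_mem[OF e] by (intro seg_closed) auto
    then show ?thesis
      using seg_g[OF e order.refl] ac[of "Suc k"] p1 c
      by (simp add: inv_mult_group a_def Pk flip: m_assoc del: upt_Suc)
  qed
  have dX: "d \<in> ?X" using d by (auto simp: PiE_iff) (simp add: d_def delta_def)
  have Lc: "L c = L (p 1) + (\<Sum>i=1..k. L (d i))"
  proof -
    have "d \<in> delta_sequences G S c k"
      using p multichain_iff_delta_sequence[OF c pX k] by (simp add: d_def)
    moreover have "c \<otimes> inv (seg d 1 (Suc k)) = p 1"
    proof -
      have "seg d 1 (Suc k) = seg (\<lambda>i. inv (a i) \<otimes> a (Suc i)) 1 (Suc k)"
        using d(1) by (intro arg_cong[where f = "list_prod G"] map_cong) auto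
      also have "\<dots> = inv (a 1) \<otimes> a (Suc k)" by (rule seg_quotients) (use ac k in auto)
      finally show ?thesis using a1 ac[of "Suc k"] p1 c
        by (simp add: a_def Pk inv_mult_group del: upt_Suc)
    qed
    ultimately show ?thesis using delta_sequence_iff[OF c dX] by simp
  qed
  have mem_iff: "e \<in> delta_sequences G S c k \<and> componentwise_le G S k d e \<longleftrightarrow>
      g e \<in> delta_sequences G S (p 1) k" if e: "e \<in> ?X" for e
  proof -
    let ?x = "L (c \<otimes> inv (seg e 1 (Suc k)))"
    have ec: "e i \<in> carrier G" if "i \<in> {1..k}" for i using PiE_mem[OF e that] .
    have le: "componentwise_le G S k d e \<longleftrightarrow> (\<forall>i\<in>{1..k}. L (e i) = L (d i) + L (g e i))"
      using ec by (simp add: componentwise_le_def abs_le_def Lg)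
    have G1: "e \<in> delta_sequences G S c k \<longleftrightarrow> L c = ?x + (\<Sum>i=1..k. L (e i))"
      by (rule delta_sequence_iff[OF c e])
    have G2: "g e \<in> delta_sequences G S (p 1) k \<longleftrightarrow> L (p 1) = ?x + (\<Sum>i=1..k. L (g e i))"
      using delta_sequence_iff[OF p1 gmem[OF e]] first[OF e] by simp
    have sum: "(\<Sum>i=1..k. L (d i) + L (g e i)) = (\<Sum>i=1..k. L (d i)) + (\<Sum>i=1..k. L (g e i))"
      by (rule sum.distrib)
    show ?thesis
    proof
      assume "e \<in> delta_sequences G S c k \<and> componentwise_le G S k d e"
      then have "L c = ?x + (\<Sum>i=1..k. L (e i))" "(\<Sum>i=1..k. L (e i)) = (\<Sum>i=1..k. L (d i) + L (g e i))"
        using G1 le by (auto intro: sum.cong)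
      then show "g e \<in> delta_sequences G S (p 1) k" using G2 Lc sum by linarith
    next
      assume "g e \<in> delta_sequences G S (p 1) k"
      then have lower: "L c = ?x + (\<Sum>i=1..k. L (d i) + L (g e i))" using G2 Lc sum by linarith
      have segc: "seg e 1 (Suc k) \<in> carrier G" using ec by (intro seg_closed) auto
      have "L c \<le> ?x + L (seg e 1 (Suc k))"
        using L_mult[of "c \<otimes> inv (seg e 1 (Suc k))" "seg e 1 (Suc k)"] c segc
        by (simp add: m_assoc del: upt_Suc)
      also have "L (seg e 1 (Suc k)) \<le> (\<Sum>i=1..<Suc k. L (e i))"
        by (rule L_seg_le) (use ec in auto)
      finally have "L c \<le> ?x + (\<Sum>i=1..k. L (e i))" by (simp add: atLeastLessThanSuc_atLeastAtMost)
      moreover have "(\<Sum>i=1..k. L (e i)) \<le> (\<Sum>i=1..k. L (d i) + L (g e i))"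
        using Lg_le ec by (intro sum_mono) auto
      ultimately have eq: "(\<Sum>i=1..k. L (e i)) = (\<Sum>i=1..k. L (d i) + L (g e i))" using lower by linarith
      \<comment> \<open>Each summand is bounded by its counterpart and the sums agree, so the summands agree.\<close>
      have "L (e i) = L (d i) + L (g e i)" if "i \<in> {1..k}" for i
        using sum_mono_inv[OF eq _ that] Lg_le ec by auto
      then show "e \<in> delta_sequences G S c k \<and> componentwise_le G S k d e"
        using le G1 eq lower by simp
    qed
  qed
  have order_iff: "componentwise_le G S k e e' \<longleftrightarrow> componentwise_le G S k (g e) (g e')"
    if e: "e \<in> ?X" "componentwise_le G S k d e" and e': "e' \<in> ?X" "componentwise_le G S k d e'" for e e'
  proof -
    have "abs_le G S (e i) (e' i) \<longleftrightarrow> abs_le G S (g e i) (g e' i)" if i: "i \<in> {1..k}" for i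
    proof -
      have ec: "e i \<in> carrier G" "e' i \<in> carrier G" using PiE_mem[OF e(1) i] PiE_mem[OF e'(1) i] .
      have "L (e i) = L (d i) + L (g e i)" "L (e' i) = L (d i) + L (g e' i)"
        using e(2) e'(2) i ec by (simp_all add: componentwise_le_def abs_le_def Lg)
      moreover have "inv (g e i) \<otimes> g e' i = conj_by G (a (Suc i)) (inv (e i) \<otimes> e' i)"
        using ec i ac[of i] ac[of "Suc i"] by (simp add: g conj_by_def inv_mult_group m_assoc)
      then have "L (inv (g e i) \<otimes> g e' i) = L (inv (e i) \<otimes> e' i)"
        using ec i ac[of "Suc i"] by simp
      ultimately show ?thesis by (simp add: abs_le_def)
    qed
    then show ?thesis by (simp add: componentwise_le_def)
  qed
  show ?filter
    unfolding poset_iso_def d_def[symmetric]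
  proof (intro conjI ballI)
    show "bij_betw g {e \<in> delta_sequences G S c k. componentwise_le G S k d e} (delta_sequences G S (p 1) k)"
      by (rule bij_betw_restrict_iff[OF gX]) (use mem_iff tuples_in_carrier(1) in blast)+
  qed (use order_iff tuples_in_carrier(1) in blast)
  have f: "f q i = q i \<otimes> (inv (p i) \<otimes> p 1)" if "i \<in> {1..k}" "q \<in> ?X" for q i
    using that pc[of i] PiE_mem[OF that(2) that(1)] p1 by (auto simp: f_def m_assoc)
  have fX: "bij_betw f ?X ?X"
  proof -
    have "bij_betw (\<lambda>q. \<lambda>i\<in>{1..k}. \<one> \<otimes> q i \<otimes> (inv (p i) \<otimes> p 1)) ?X ?X"
      by (rule bij_betw_translate_tuples) (use pc p1 in auto)
    moreover have "f q = (\<lambda>i\<in>{1..k}. \<one> \<otimes> q i \<otimes> (inv (p i) \<otimes> p 1))" if "q \<in> ?X" for q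
      using f[OF _ that] PiE_mem[OF that] by (auto simp: f_def fun_eq_iff restrict_def)
    ultimately show ?thesis using bij_betw_cong[of ?X f] by simp
  qed
  have fmem: "f q \<in> ?X" if "q \<in> ?X" for q using bij_betwE[OF fX] that by blast
  have delta_f: "delta G (p 1) k (f q) = g (delta G c k q)" if q: "q \<in> ?X" for q
  proof
    fix i
    show "delta G (p 1) k (f q) i = g (delta G c k q) i"
    proof (cases "i \<in> {1..k}")
      case True
      have Qi: "q j \<in> carrier G" if "j \<in> {1..k}" for j using PiE_mem[OF q that] .
      \<comment> \<open>For \<open>i = k\<close> both sides use their conventional last entry, \<open>\<pi>\<^sub>1\<close> and \<open>c\<close>.\<close>
      have next_entry: "((f q)(Suc k := p 1)) (Suc i) = (q(Suc k := c)) (Suc i) \<otimes> (inv (P (Suc i)) \<otimes> p 1)"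
        using True f[OF _ q, of "Suc i"] Pp[of "Suc i"] Pk c p1 by (cases "i = k") auto
      have Qs: "(q(Suc k := c)) (Suc i) \<in> carrier G" using True Qi c by auto
      have "delta G (p 1) k (f q) i =
          inv (q i \<otimes> (inv (p i) \<otimes> p 1)) \<otimes> ((q(Suc k := c)) (Suc i) \<otimes> (inv (P (Suc i)) \<otimes> p 1))"
        using True by (simp only: delta_def restrict_apply' next_entry f[OF True q])
      also have "\<dots> = g (delta G c k q) i"
      proof -
        have di: "delta G c k q i = inv (q i) \<otimes> (q(Suc k := c)) (Suc i)"
          using True by (simp only: delta_def restrict_apply')
        show ?thesis
          using True Qi[OF True] Qs pc[OF True] p1 Pc[of "Suc i"]
          by (simp only: g_def restrict_apply' di) (simp add: inv_mult_group m_assoc del: fun_upd_apply)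
      qed
      finally show ?thesis .
    next
      case False
      then show ?thesis by (simp only: delta_def g_def restrict_def if_False)
    qed
  qed
  have deltaX: "delta G c k q \<in> ?X" if "q \<in> ?X" for q
    using PiE_mem[OF that] c by (auto simp: delta_def PiE_iff)
  show ?ideal
    unfolding poset_iso_def
  proof (intro conjI ballI)
    show "bij_betw f {q \<in> multichains G S c k. multichain_le G S c k q p} (multichains G S (p 1) k)"
    proof (rule bij_betw_restrict_iff[OF fX])
      fix q assume q: "q \<in> ?X"
      show "q \<in> {q \<in> multichains G S c k. multichain_le G S c k q p} \<longleftrightarrow> f q \<in> multichains G S (p 1) k"
        using multichain_iff_delta_sequence[OF c q k] multichain_iff_delta_sequence[OF p1 fmem[OF q] k]
          delta_f[OF q] mem_iff[OF deltaX[OF q]]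
        by (simp add: multichain_le_def d_def)
    qed (use tuples_in_carrier(2) in auto)
  next
    fix q q'
    assume "q \<in> {q \<in> multichains G S c k. multichain_le G S c k q p}"
      "q' \<in> {q \<in> multichains G S c k. multichain_le G S c k q p}"
    then have q: "q \<in> ?X" "q' \<in> ?X" and "componentwise_le G S k d (delta G c k q)"
      "componentwise_le G S k d (delta G c k q')"
      using tuples_in_carrier(2) by (auto simp: multichain_le_def d_def)
    then show "multichain_le G S c k q q' \<longleftrightarrow> multichain_le G S (p 1) k (f q) (f q')"
      unfolding multichain_le_def delta_f[OF q(1)] delta_f[OF q(2)]
      using order_iff deltaX q by blast
  qed
qed

lemma coxeter_element_closed: "coxeter_element G S c \<Longrightarrow> c \<in> carrier G"
  using gens_closed by (auto simp: coxeter_element_def)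

lemma coxeter_element_parabolic_mem:
  assumes P: "parabolic_subgroup G S H S'" and y: "coxeter_element (G\<lparr>carrier := H\<rparr>) S' y"
  shows "y \<in> H"
proof -
  have sub: "subgroup H G" using P by (rule parabolic_subgroup_subgroup)
  have "S' \<subseteq> H" using P generate.incl[of _ _ G] unfolding parabolic_subgroup_def by blast
  moreover obtain w xs where w: "w \<in> H" "set xs = S'" "y = conj_by (G\<lparr>carrier := H\<rparr>) w (list_prod G xs)"
    using y by (auto simp: coxeter_element_def)
  ultimately have "list_prod G xs \<in> H" by (intro list_prod_in_subgroup[OF sub]) simp
  then show ?thesis using w conj_in_subgroup[OF sub] by (simp add: conj_by_carrier_update[OF sub])
qed

end

lemma poset_iso_cong:
  assumes "poset_iso f A leA B leB" "\<And>x y. x \<in> B \<Longrightarrow> y \<in> B \<Longrightarrow> leB' x y = leB x y"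
  shows "poset_iso f A leA B leB'"
  using assms bij_betwE unfolding poset_iso_def by metis

theorem theorem3p4p8:
  fixes G :: "('a, 'b) monoid_scheme" and S :: "'a set" and c :: 'a and k :: nat
    and p :: "nat \<Rightarrow> 'a" and H S' :: "'a set"
  assumes "finite_coxeter_system G S"
    and "coxeter_element G S c"
    and "k \<ge> 1"
    and "p \<in> multichains G S c k"
    and "parabolic_subgroup G S H S'"
    and "coxeter_element (G\<lparr>carrier := H\<rparr>) S' (p 1)"
  shows "poset_iso
      (\<lambda>q. \<lambda>i\<in>{1..k}. if i = 1 then q 1 else q i \<otimes>\<^bsub>G\<^esub> inv\<^bsub>G\<^esub> (p i) \<otimes>\<^bsub>G\<^esub> p 1)
      {q \<in> multichains G S c k. multichain_le G S c k q p}
      (multichain_le G S c k)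
      (multichains (G\<lparr>carrier := H\<rparr>) S' (p 1) k)
      (multichain_le (G\<lparr>carrier := H\<rparr>) S' (p 1) k)
    \<and> poset_iso
      (\<lambda>e. \<lambda>i\<in>{1..k}. inv\<^bsub>G\<^esub> (p 1) \<otimes>\<^bsub>G\<^esub> p i \<otimes>\<^bsub>G\<^esub> e i
          \<otimes>\<^bsub>G\<^esub> inv\<^bsub>G\<^esub> ((p(Suc k := c)) (Suc i)) \<otimes>\<^bsub>G\<^esub> p 1)
      {e \<in> delta_sequences G S c k. componentwise_le G S k (delta G c k p) e}
      (componentwise_le G S k)
      (delta_sequences (G\<lparr>carrier := H\<rparr>) S' (p 1) k)
      (componentwise_le (G\<lparr>carrier := H\<rparr>) S' k)"
proof -
  interpret coxeter_system G S
    using assms(1) by (simp add: finite_coxeter_system_def)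
  have c: "c \<in> carrier G" using assms(2) by (rule coxeter_element_closed)
  note P = assms(5)
  have p1: "p 1 \<in> H" using coxeter_element_parabolic_mem[OF P assms(6)] .
  note iso = multichain_posets_iso[OF c assms(3,4)]
  have mem: "q i \<in> H" if "q \<in> {1..k} \<rightarrow>\<^sub>E NC G S (p 1)" "i \<in> {1..k}" for q i
    using PiE_mem[OF that] NC_parabolic(2)[OF P p1] by blast
  have "multichain_le (G\<lparr>carrier := H\<rparr>) S' (p 1) k q q' = multichain_le G S (p 1) k q q'"
    if "q \<in> multichains G S (p 1) k" "q' \<in> multichains G S (p 1) k" for q q'
    using that mem[of q] mem[of q'] by (intro multichain_le_parabolic[OF P p1]) (auto simp: multichains_def)
  note ideal = poset_iso_cong[OF iso(1) this]
  have "componentwise_le (G\<lparr>carrier := H\<rparr>) S' k e e' = componentwise_le G S k e e'"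
    if "e \<in> delta_sequences G S (p 1) k" "e' \<in> delta_sequences G S (p 1) k" for e e'
    using that mem[of e] mem[of e'] by (intro componentwise_le_parabolic[OF P]) (auto simp: delta_sequences_def)
  note filter = poset_iso_cong[OF iso(2) this]
  show ?thesis
    unfolding multichains_parabolic[OF P p1] delta_sequences_parabolic[OF P p1]
    using ideal filter by (rule conjI)
qed

end
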